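(* Let $\|\cdot\|_Z$ be a strictly monotone norm on $\mathbb{R}^2$. Suppose $X$ is a Banach space with the weak fixed point property (WFPP) and $Y$ is a Banach space which is uniformly convex in every direction. Then the direct sum $X\oplus_Z Y$ has the weak fixed point property.
   Context: A mapping $T:C\to C$ on a subset $C$ of a Banach space is nonexpansive if $\|Tx-Ty\|\le\|x-y\|$ for all $x,y\in C$. A Banach space has the weak fixed point property (WFPP) if every nonexpansive self-mapping of a nonempty weakly compact convex subset of it has a fixed point. A norm $\|\cdot\|$ on $\mathbb{R}^2$ is strictly monotone if $\|(x_1,y_1)\|<\|(x_2,y_2)\|$ whenever either $0\le x_1\le x_2$ and $0\le y_1<y_2$, or $0\le x_1<x_2$ and $0\le y_1\le y_2$. For a normed space $Z=(\mathbb{R}^2,\|\cdot\|_Z)$ and Banach spaces $X,Y$, $X\oplus_Z Y$ denotes $X\times Y$ with the norm $\|(x,y)\|=\|(\|x\|,\|y\|)\|_Z$. A Banach space $Y$ is uniformly convex in every direction if for every $z\in Y$ with $\|z\|=1$ and every $\varepsilon\in(0,2]$ there is $\delta>0$ such that $\left\|\frac{x+y}{2}\right\|\le 1-\delta$ whenever $x,y\in Y$, $\|x\|\le1$, $\|y\|\le 1$, and $x-y=\lambda z$ for some real $\lambda$ with $|\lambda|\ge\varepsilon$. *)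

theory Defs
  imports "HOL-Analysis.Analysis"
begin

text \<open>
  The direct sum depends on the norm of Z, so its norm cannot be the one supplied by a type class
  (the product type already carries the Euclidean product norm). Norms are therefore passed
  as functions wherever the direct sum is involved; a Banach space of class \<^class>\<open>banach\<close> is
  the case \<open>N = norm\<close>.
\<close>

definition is_norm :: "('a::real_vector \<Rightarrow> real) \<Rightarrow> bool" where
  "is_norm N \<longleftrightarrow>
     (\<forall>x. 0 \<le> N x) \<and> (\<forall>x. N x = 0 \<longleftrightarrow> x = 0) \<and>
     (\<forall>c x. N (c *\<^sub>R x) = \<bar>c\<bar> * N x) \<and> (\<forall>x y. N (x + y) \<le> N x + N y)"

definition complete_norm :: "('a::real_vector \<Rightarrow> real) \<Rightarrow> bool" where
  "complete_norm N \<longleftrightarrow> is_norm N \<and> Metric_space.mcomplete UNIV (\<lambda>x y. N (x - y))"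

definition dual_functionals :: "('a::real_vector \<Rightarrow> real) \<Rightarrow> ('a \<Rightarrow> real) set" where
  "dual_functionals N = {f. linear f \<and> (\<exists>K. \<forall>x. \<bar>f x\<bar> \<le> K * N x)}"

definition weak_topology :: "('a::real_vector \<Rightarrow> real) \<Rightarrow> 'a topology" where
  "weak_topology N = topology_generated_by {f -` U |f U. f \<in> dual_functionals N \<and> open U}"

definition nonexpansive_on :: "('a::real_vector \<Rightarrow> real) \<Rightarrow> 'a set \<Rightarrow> ('a \<Rightarrow> 'a) \<Rightarrow> bool" where
  "nonexpansive_on N C T \<longleftrightarrow> (\<forall>x\<in>C. \<forall>y\<in>C. N (T x - T y) \<le> N (x - y))"

definition weak_fixed_point_property :: "('a::real_vector \<Rightarrow> real) \<Rightarrow> bool" where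
  "weak_fixed_point_property N \<longleftrightarrow>
     (\<forall>C T. C \<noteq> {} \<and> convex C \<and> compactin (weak_topology N) C \<and>
            T \<in> C \<rightarrow> C \<and> nonexpansive_on N C T \<longrightarrow> (\<exists>x\<in>C. T x = x))"

definition strictly_monotone :: "(real \<times> real \<Rightarrow> real) \<Rightarrow> bool" where
  "strictly_monotone N \<longleftrightarrow>
     (\<forall>x1 y1 x2 y2.
        (0 \<le> x1 \<and> x1 \<le> x2 \<and> 0 \<le> y1 \<and> y1 < y2) \<or> (0 \<le> x1 \<and> x1 < x2 \<and> 0 \<le> y1 \<and> y1 \<le> y2)
        \<longrightarrow> N (x1, y1) < N (x2, y2))"

definition direct_sum_norm ::
    "(real \<times> real \<Rightarrow> real) \<Rightarrow> 'a::real_normed_vector \<times> 'b::real_normed_vector \<Rightarrow> real" where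
  "direct_sum_norm nZ = (\<lambda>(x, y). nZ (norm x, norm y))"

definition uniformly_convex_in_every_direction :: "'b::real_normed_vector itself \<Rightarrow> bool" where
  "uniformly_convex_in_every_direction TYPE('b) \<longleftrightarrow>
     (\<forall>z::'b. \<forall>\<epsilon>::real. norm z = 1 \<and> 0 < \<epsilon> \<and> \<epsilon> \<le> 2 \<longrightarrow>
        (\<exists>\<delta>>0. \<forall>x y. \<forall>l::real.
           norm x \<le> 1 \<and> norm y \<le> 1 \<and> x - y = l *\<^sub>R z \<and> \<bar>l\<bar> \<ge> \<epsilon>
           \<longrightarrow> norm ((1/2) *\<^sub>R (x + y)) \<le> 1 - \<delta>))"

lemma dual_functionals_norm:
  "dual_functionals (norm :: 'a::real_normed_vector \<Rightarrow> real) = {f. bounded_linear f}"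
proof -
  have "(\<exists>K. \<forall>x. \<bar>f x\<bar> \<le> K * norm x) \<longleftrightarrow> (\<exists>K. \<forall>x. norm (f x) \<le> norm x * K)"
    for f :: "'a \<Rightarrow> real"
    by (simp add: mult.commute)
  then show ?thesis
    by (auto simp: dual_functionals_def bounded_linear_def bounded_linear_axioms_def)
qed

lemma weak_topology_norm:
  "weak_topology (norm :: 'a::real_normed_vector \<Rightarrow> real) =
     topology_generated_by {f -` U |(f :: 'a \<Rightarrow> real) U. bounded_linear f \<and> open U}"
  by (simp add: weak_topology_def dual_functionals_norm)

lemma topspace_weak_topology: "topspace (weak_topology N) = UNIV"
proof -
  have "linear (\<lambda>x::'a. 0::real) \<and> (\<exists>K. \<forall>x. \<bar>0\<bar> \<le> K * N x)"
    by (auto intro!: exI[of _ 0] simp: linear_iff)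
  then have "(\<lambda>x::'a. 0::real) -` UNIV \<in> {f -` U |f U. f \<in> dual_functionals N \<and> open U}"
    unfolding dual_functionals_def by blast
  then show ?thesis
    by (auto simp: weak_topology_def)
qed

lemma is_norm_Metric_space:
  assumes "is_norm N" shows "Metric_space UNIV (\<lambda>x y. N (x - y))"
proof
  note n = assms[unfolded is_norm_def]
  show "0 \<le> N (x - y)" for x y using n by blast
  show "N (x - y) = N (y - x)" for x y
    using n by (metis abs_minus_cancel abs_one minus_diff_eq mult_1 scaleR_minus1_left)
  show "N (x - y) = 0 \<longleftrightarrow> x = y" for x y using n by simp
  show "N (x - z) \<le> N (x - y) + N (y - z)" for x y z
    using n by (metis diff_add_cancel add_diff_eq)
qed

lemma strictly_monotone_mono:
  assumes "strictly_monotone N" "0 \<le> a" "a \<le> a'" "0 \<le> b" "b \<le> b'"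
  shows "N (a, b) \<le> N (a', b')"
proof (cases "a = a' \<and> b = b'")
  case False
  then have "N (a, b) < N (a', b')"
    using assms unfolding strictly_monotone_def by (metis order_le_less)
  then show ?thesis by simp
qed simp

lemma is_norm_direct_sum:
  assumes nZ: "is_norm nZ" and mono: "strictly_monotone nZ"
  shows "is_norm (direct_sum_norm nZ :: 'a::real_normed_vector \<times> 'b::real_normed_vector \<Rightarrow> real)"
    (is "is_norm ?N")
proof -
  note n = nZ[unfolded is_norm_def]
  have "?N (p + q) \<le> ?N p + ?N q" for p q
  proof -
    obtain a b c d where pq: "p = (a, b)" "q = (c, d)" by (cases p, cases q) auto
    have "nZ (norm (a + c), norm (b + d)) \<le> nZ (norm a + norm c, norm b + norm d)"
      by (intro strictly_monotone_mono[OF mono] norm_triangle_ineq norm_ge_zero)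
    also have "\<dots> \<le> nZ (norm a, norm b) + nZ (norm c, norm d)"
      using n by (metis add_Pair)
    finally show ?thesis by (simp add: pq direct_sum_norm_def)
  qed
  moreover have "?N (c *\<^sub>R p) = \<bar>c\<bar> * ?N p" for c p
  proof -
    obtain a b where p: "p = (a, b)" by (cases p)
    have "nZ (\<bar>c\<bar> *\<^sub>R (norm a, norm b)) = \<bar>\<bar>c\<bar>\<bar> * nZ (norm a, norm b)"
      using n by blast
    then show ?thesis by (simp add: p direct_sum_norm_def)
  qed
  moreover have "?N p = 0 \<longleftrightarrow> p = 0" for p
    using n by (cases p) (simp add: direct_sum_norm_def zero_prod_def)
  moreover have "0 \<le> ?N p" for p
    using n by (cases p) (simp add: direct_sum_norm_def)
  ultimately show ?thesis
    unfolding is_norm_def by blast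
qed

lemma complete_norm_direct_sum:
  assumes nZ: "is_norm nZ" and mono: "strictly_monotone nZ"
  shows "complete_norm (direct_sum_norm nZ :: 'a::banach \<times> 'b::banach \<Rightarrow> real)"
    (is "complete_norm ?N")
proof -
  note n = nZ[unfolded is_norm_def]
  have N: "is_norm ?N" by (rule is_norm_direct_sum[OF nZ mono])
  interpret M: Metric_space UNIV "\<lambda>p q. ?N (p - q)" by (rule is_norm_Metric_space[OF N])
  define \<alpha> \<beta> where "\<alpha> = nZ (1, 0)" and "\<beta> = nZ (0, 1)"
  have pos: "\<alpha> > 0" "\<beta> > 0"
    using n unfolding \<alpha>_def \<beta>_def by (simp_all add: order_less_le zero_prod_def)
  have sc: "nZ (t, 0) = t * \<alpha>" "nZ (0, t) = t * \<beta>" if "t \<ge> 0" for t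
  proof -
    have "nZ (t *\<^sub>R (1, 0)) = \<bar>t\<bar> * \<alpha>" "nZ (t *\<^sub>R (0, 1)) = \<bar>t\<bar> * \<beta>"
      using n unfolding \<alpha>_def \<beta>_def by blast+
    then show "nZ (t, 0) = t * \<alpha>" "nZ (0, t) = t * \<beta>" using that by simp_all
  qed
  have lo: "norm (fst p) * \<alpha> \<le> ?N p" "norm (snd p) * \<beta> \<le> ?N p" for p
    using strictly_monotone_mono[OF mono, of "norm (fst p)" "norm (fst p)" 0 "norm (snd p)"]
      strictly_monotone_mono[OF mono, of 0 "norm (fst p)" "norm (snd p)" "norm (snd p)"]
    by (simp_all add: sc direct_sum_norm_def case_prod_unfold)
  have hi: "?N p \<le> norm (fst p) * \<alpha> + norm (snd p) * \<beta>" for p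
  proof -
    have "nZ ((norm (fst p), 0) + (0, norm (snd p))) \<le> nZ (norm (fst p), 0) + nZ (0, norm (snd p))"
      using n by blast
    then show ?thesis by (simp add: sc direct_sum_norm_def case_prod_unfold)
  qed
  have "M.mcomplete"
    unfolding M.mcomplete_def
  proof (intro allI impI)
    fix s :: "nat \<Rightarrow> 'a \<times> 'b"
    assume "M.MCauchy s"
    then have C: "\<exists>K. \<forall>m n. K \<le> m \<longrightarrow> K \<le> n \<longrightarrow> ?N (s m - s n) < e" if "e > 0" for e
      using that unfolding M.MCauchy_def by blast
    have "Cauchy (\<lambda>n. fst (s n))"
    proof (rule CauchyI)
      fix e :: real assume "e > 0"
      then obtain K where K: "\<And>m n. K \<le> m \<Longrightarrow> K \<le> n \<Longrightarrow> ?N (s m - s n) < e * \<alpha>"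
        using C[of "e * \<alpha>"] pos by auto
      have "norm (fst (s m) - fst (s n)) < e" if "m \<ge> K" "n \<ge> K" for m n
        using K[OF that] lo(1)[of "s m - s n"] pos(1)
        by (metis fst_diff mult_less_cancel_right_pos order_le_less_trans)
      then show "\<exists>K. \<forall>m\<ge>K. \<forall>n\<ge>K. norm (fst (s m) - fst (s n)) < e" by blast
    qed
    then obtain a where a: "(\<lambda>n. fst (s n)) \<longlonglongrightarrow> a"
      using Cauchy_convergent convergent_def by blast
    have "Cauchy (\<lambda>n. snd (s n))"
    proof (rule CauchyI)
      fix e :: real assume "e > 0"
      then obtain K where K: "\<And>m n. K \<le> m \<Longrightarrow> K \<le> n \<Longrightarrow> ?N (s m - s n) < e * \<beta>"
        using C[of "e * \<beta>"] pos by auto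
      have "norm (snd (s m) - snd (s n)) < e" if "m \<ge> K" "n \<ge> K" for m n
        using K[OF that] lo(2)[of "s m - s n"] pos(2)
        by (metis snd_diff mult_less_cancel_right_pos order_le_less_trans)
      then show "\<exists>K. \<forall>m\<ge>K. \<forall>n\<ge>K. norm (snd (s m) - snd (s n)) < e" by blast
    qed
    then obtain b where b: "(\<lambda>n. snd (s n)) \<longlonglongrightarrow> b"
      using Cauchy_convergent convergent_def by blast
    have "(\<lambda>n. norm (fst (s n) - a) * \<alpha> + norm (snd (s n) - b) * \<beta>) \<longlonglongrightarrow> norm (a - a) * \<alpha> + norm (b - b) * \<beta>"
      by (intro tendsto_intros a b)
    then have lim: "(\<lambda>n. norm (fst (s n) - a) * \<alpha> + norm (snd (s n) - b) * \<beta>) \<longlonglongrightarrow> 0"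
      by simp
    have "(\<lambda>n. ?N (s n - (a, b))) \<longlonglongrightarrow> 0"
    proof (rule tendsto_sandwich[OF _ _ tendsto_const lim])
      show "\<forall>\<^sub>F n in sequentially. 0 \<le> ?N (s n - (a, b))"
        using N unfolding is_norm_def by simp
      show "\<forall>\<^sub>F n in sequentially. ?N (s n - (a, b)) \<le> norm (fst (s n) - a) * \<alpha> + norm (snd (s n) - b) * \<beta>"
        using hi[of "s _ - (a, b)"] by simp
    qed
    then show "\<exists>x. limitin M.mtopology s x sequentially"
      by (auto simp: M.limitin_metric_dist_null)
  qed
  with N show ?thesis by (simp add: complete_norm_def)
qed

end

theory Submission
  imports Defs
begin

text \<open>
  A nonexpansive self-map \<open>T\<close> of a weakly compact convex set has a minimal closed convex invariant set
  \<open>C\<close>. The theorem holds because the second coordinate is constant on \<open>C\<close>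
  (\<open>minimal_invariant_in_slice\<close>): then \<open>C\<close> is a weakly compact convex subset of the first factor, where \<open>T\<close>
  acts as a nonexpansive map, and the weak fixed point property of that factor applies.

  Let \<open>v n\<close> be an approximate fixed point sequence in \<open>C\<close>. By the Goebel-Karlovitz lemma
  (\<open>goebel_karlovitz\<close>) the distances of \<open>v n\<close> to all points of \<open>C\<close> tend to the same number \<open>d\<close>. Strict
  monotonicity turns this into two statements about second coordinates.

  Firstly, the distances of \<open>snd (v n)\<close> to the points of \<open>snd ` C\<close> are asymptotically affine functions of
  these points (\<open>snd_dist_asymptotically_affine\<close>). Uniform convexity in every direction forbids distinct
  points with equal limit distance, and an injective affine real function exists only on a segment. So
  \<open>snd ` C\<close> lies on a line, and after passing to a subsequence \<open>snd (v n)\<close> converges to some \<open>y0\<close>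
  (\<open>uced_convergent_subsequence\<close>).

  Secondly, let \<open>g\<close> be obtained from \<open>T\<close> by compositions and convex combinations. It is nonexpansive
  and asymptotically fixes \<open>v n\<close>, so it maps the segment from a point \<open>e\<close> to \<open>v n\<close> almost onto a geodesic
  from \<open>g e\<close> to \<open>v n\<close>. Strict monotonicity makes the second coordinates follow an almost geodesic path too.
  Hence on the whole segment the second coordinate of the image is no farther from \<open>y0\<close> than that of
  \<open>g e\<close>, up to a small error (\<open>segment_height\<close>). Adding sparse terms of the sequence one by one keeps
  the second coordinates of the images of whole convex hulls close to \<open>y0\<close>, and a weak cluster point \<open>c\<close>
  of the chosen terms satisfies \<open>snd (g c) = y0\<close> for all such \<open>g\<close> at once (\<open>flat_point_exists\<close>). By
  minimality the points \<open>g c\<close> are dense in \<open>C\<close>, so \<open>snd\<close> is constant on \<open>C\<close>.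

  The facts about weakly compact sets behind these steps, among them that closed convex sets are weakly
  closed, rest on a Hahn-Banach separation (\<open>closed_convex_separation\<close>).
\<close>

section \<open>The Hahn-Banach separation of a point from a closed convex set\<close>

definition sublinear :: "('a::real_vector \<Rightarrow> real) \<Rightarrow> bool" where
  "sublinear p \<longleftrightarrow> (\<forall>x y. p (x + y) \<le> p x + p y) \<and> (\<forall>t\<ge>0. \<forall>x. p (t *\<^sub>R x) = t * p x)"

lemma sublinear_zero: "sublinear p \<Longrightarrow> p 0 = 0"
  unfolding sublinear_def by (metis mult_zero_left order_refl scaleR_zero_left)

lemma sublinear_lower: "sublinear p \<Longrightarrow> - p (- x) \<le> p x"
  using sublinear_zero[of p] unfolding sublinear_def
  by (metis add.commute add.right_inverse le_add_same_cancel2 minus_le_iff neg_le_iff_le add_le_cancel_left diff_0 diff_le_eq)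

text \<open>
  Every sublinear functional below is an infimum of simpler ones; the hypotheses are the
  pointwise inequalities that survive the passage to the infimum. Scaling is needed in one direction
  only, since the reverse inequality is the same one for the inverse factor.
\<close>

lemma sublinear_INF:
  fixes F :: "'i \<Rightarrow> 'a::real_vector \<Rightarrow> real"
  assumes ne: "I \<noteq> {}"
    and bdd: "\<And>x. bdd_below ((\<lambda>i. F i x) ` I)"
    and scale: "\<And>i t x. i \<in> I \<Longrightarrow> t > 0 \<Longrightarrow> \<exists>j\<in>I. F j (t *\<^sub>R x) \<le> t * F i x"
    and add: "\<And>i j x y. i \<in> I \<Longrightarrow> j \<in> I \<Longrightarrow> \<exists>k\<in>I. F k (x + y) \<le> F i x + F j y"
    and zero: "\<And>i. i \<in> I \<Longrightarrow> 0 \<le> F i 0" "\<exists>i\<in>I. F i 0 \<le> 0"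
  shows "sublinear (\<lambda>x. INF i\<in>I. F i x)"
proof -
  define q where "q x = (INF i\<in>I. F i x)" for x
  have low: "q x \<le> F i x" if "i \<in> I" for i x
    unfolding q_def using bdd that by (rule cINF_lower)
  have great: "m \<le> q x" if "\<And>i. i \<in> I \<Longrightarrow> m \<le> F i x" for m x
    unfolding q_def using ne that by (rule cINF_greatest)
  have sub: "q (x + y) \<le> q x + q y" for x y
  proof -
    have "q (x + y) - F j y \<le> q x" if j: "j \<in> I" for j
    proof (rule great)
      fix i assume i: "i \<in> I"
      then obtain k where "k \<in> I" "F k (x + y) \<le> F i x + F j y" using add j by blast
      then show "q (x + y) - F j y \<le> F i x" using low[of k "x + y"] by linarith
    qed
    then have "q (x + y) - q x \<le> q y" by (intro great) (simp add: algebra_simps)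
    then show ?thesis by simp
  qed
  have half: "q (t *\<^sub>R x) \<le> t * q x" if "t > 0" for t x
  proof -
    have "q (t *\<^sub>R x) / t \<le> q x"
    proof (rule great)
      fix i assume "i \<in> I"
      then obtain j where "j \<in> I" "F j (t *\<^sub>R x) \<le> t * F i x" using scale \<open>t > 0\<close> by blast
      then have "q (t *\<^sub>R x) \<le> t * F i x" using low[of j "t *\<^sub>R x"] by linarith
      then show "q (t *\<^sub>R x) / t \<le> F i x" using \<open>t > 0\<close> by (simp add: field_simps)
    qed
    then show ?thesis using \<open>t > 0\<close> by (simp add: field_simps)
  qed
  have q0: "q 0 = 0"
  proof (rule antisym)
    show "q 0 \<le> 0" using zero(2) low order_trans by blast
    show "0 \<le> q 0" using zero(1) by (rule great)
  qed
  have "q (t *\<^sub>R x) = t * q x" if "t \<ge> 0" for t x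
  proof (cases "t = 0")
    case False
    with that have t: "t > 0" by simp
    have "q ((1/t) *\<^sub>R (t *\<^sub>R x)) \<le> (1/t) * q (t *\<^sub>R x)" by (rule half) (use t in simp)
    then have "t * q x \<le> q (t *\<^sub>R x)" using t by (simp add: field_simps)
    then show ?thesis using half[OF t, of x] by linarith
  qed (simp add: q0)
  then show ?thesis unfolding sublinear_def q_def[symmetric] using sub by blast
qed

text \<open>
  Linear functionals are exactly the minimal sublinear ones, so Zorn's lemma applied to the sublinear
  functionals below \<open>p\<close> yields one without extending partially defined functionals. If \<open>m\<close> is minimal
  and \<open>y\<close> is fixed, the infimum over \<open>t \<ge> 0\<close> of \<open>m (z + t y) - t m y\<close> is sublinear and at most \<open>m\<close>,
  hence equal to \<open>m\<close>; the value at \<open>t = 1\<close> gives the inequality opposite to subadditivity.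
\<close>

lemma linear_below_sublinear:
  fixes p :: "'a::real_vector \<Rightarrow> real"
  assumes p: "sublinear p"
  shows "\<exists>f. linear f \<and> (\<forall>x. f x \<le> p x)"
proof -
  define A where "A = {q. sublinear q \<and> (\<forall>x. q x \<le> p x)}"
  let ?P = "\<lambda>q r :: 'a \<Rightarrow> real. \<forall>x. r x \<le> q x"
  have "\<exists>m\<in>A. \<forall>a\<in>A. ?P m a \<longrightarrow> a = m"
  proof (rule predicate_Zorn)
    show "partial_order_on A (relation_of ?P A)"
      by (rule partial_order_on_relation_ofI) (auto intro: order_trans order_antisym simp: fun_eq_iff)
    fix Q assume Q: "Q \<in> Chains (relation_of ?P A)"
    then have QA: "Q \<subseteq> A" and ch: "\<And>q r. q \<in> Q \<Longrightarrow> r \<in> Q \<Longrightarrow> ?P q r \<or> ?P r q"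
      by (auto simp: Chains_def relation_of_def)
    show "\<exists>u\<in>A. \<forall>a\<in>Q. ?P a u"
    proof (cases "Q = {}")
      case True
      then show ?thesis using p by (auto simp: A_def)
    next
      case False
      have bdd: "bdd_below ((\<lambda>q. q x) ` Q)" for x
      proof (rule bdd_belowI2)
        fix q assume "q \<in> Q"
        then have "sublinear q" "q (- x) \<le> p (- x)" using QA by (auto simp: A_def)
        then show "- p (- x) \<le> q x" using sublinear_lower[of q x] by linarith
      qed
      have sl: "sublinear q" if "q \<in> Q" for q using QA that by (auto simp: A_def)
      have "sublinear (\<lambda>x. INF q\<in>Q. q x)"
      proof (rule sublinear_INF[OF False bdd])
        show "\<exists>j\<in>Q. j (t *\<^sub>R x) \<le> t * i x" if "i \<in> Q" "t > 0" for i t x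
          using sl[OF that(1)] that unfolding sublinear_def by (metis less_le order_refl)
        show "\<exists>k\<in>Q. k (x + y) \<le> i x + j y" if "i \<in> Q" "j \<in> Q" for i j x y
        proof (cases "?P i j")
          case True
          have "j (x + y) \<le> j x + j y" using sl[OF that(2)] unfolding sublinear_def by blast
          also have "\<dots> \<le> i x + j y" using True by simp
          finally show ?thesis using that by blast
        next
          case F: False
          then have ji: "?P j i" using ch that by blast
          have "i (x + y) \<le> i x + i y" using sl[OF that(1)] unfolding sublinear_def by blast
          also have "\<dots> \<le> i x + j y" using ji by simp
          finally show ?thesis using that by blast
        qed
        show "0 \<le> i 0" if "i \<in> Q" for i using sublinear_zero[OF sl[OF that]] by simp
        show "\<exists>i\<in>Q. i 0 \<le> 0" using False sublinear_zero[OF sl] by fastforce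
      qed
      moreover have "(INF q\<in>Q. q x) \<le> q x" if "q \<in> Q" for q x
        using bdd that by (rule cINF_lower)
      moreover have "(INF q\<in>Q. q x) \<le> p x" for x
        using False QA calculation(2)[of _ x] unfolding A_def by (force intro: order_trans)
      ultimately show ?thesis
        by (intro bexI[of _ "\<lambda>x. INF q\<in>Q. q x"]) (auto simp: A_def)
    qed
  qed
  then obtain m where mA: "m \<in> A" and min: "\<And>a. a \<in> A \<Longrightarrow> ?P m a \<Longrightarrow> a = m" by blast
  have m: "sublinear m" and mp: "\<And>x. m x \<le> p x" using mA by (auto simp: A_def)
  have msub: "m (x + y) \<le> m x + m y" and mhom: "t \<ge> 0 \<Longrightarrow> m (t *\<^sub>R x) = t * m x" for x y t
    using m unfolding sublinear_def by blast+
  have sup: "m x + m y \<le> m (x + y)" for x y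
  proof -
    define F where "F t z = m (z + t *\<^sub>R y) - t * m y" for t z
    have bdd: "bdd_below ((\<lambda>t. F t z) ` {0..})" for z
    proof (rule bdd_belowI2)
      fix t :: real assume "t \<in> {0..}"
      then have "t * m y = m (t *\<^sub>R y)" using mhom by simp
      also have "\<dots> = m ((z + t *\<^sub>R y) + (- z))" by simp
      also have "\<dots> \<le> m (z + t *\<^sub>R y) + m (- z)" by (rule msub)
      finally show "- m (- z) \<le> F t z" unfolding F_def by linarith
    qed
    have "sublinear (\<lambda>z. INF t\<in>{0..}. F t z)"
    proof (rule sublinear_INF[OF _ bdd])
      show "\<exists>j\<in>{0..}. F j (t *\<^sub>R z) \<le> t * F i z" if "i \<in> {0..}" "t > 0" for i t z
      proof (intro bexI[of _ "t * i"])
        have "m (t *\<^sub>R z + (t * i) *\<^sub>R y) = t * m (z + i *\<^sub>R y)"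
          using mhom[of t "z + i *\<^sub>R y"] that by (simp add: scaleR_add_right)
        then show "F (t * i) (t *\<^sub>R z) \<le> t * F i z" by (simp add: F_def algebra_simps)
      qed (use that in auto)
      show "\<exists>k\<in>{0..}. F k (z + w) \<le> F i z + F j w" if "i \<in> {0..}" "j \<in> {0..}" for i j z w
      proof (intro bexI[of _ "i + j"])
        show "F (i + j) (z + w) \<le> F i z + F j w"
          using msub[of "z + i *\<^sub>R y" "w + j *\<^sub>R y"] by (simp add: F_def algebra_simps)
      qed (use that in auto)
      show "0 \<le> F i 0" if "i \<in> {0..}" for i using that mhom by (simp add: F_def)
      show "\<exists>i\<in>{0..}. F i 0 \<le> 0"
        by (rule bexI[of _ 0]) (simp_all add: F_def sublinear_zero[OF m])
    qed auto
    moreover have low: "(INF t\<in>{0..}. F t z) \<le> F t z" if "t \<ge> 0" for t z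
      using bdd that by (intro cINF_lower) auto
    moreover have le: "(INF t\<in>{0..}. F t z) \<le> m z" for z
      using low[of 0 z] by (simp add: F_def)
    ultimately have "(\<lambda>z. INF t\<in>{0..}. F t z) \<in> A"
      using mp unfolding A_def by (blast intro: order_trans)
    then have "(\<lambda>z. INF t\<in>{0..}. F t z) = m" using min le by blast
    then have "m x \<le> F 1 x" using low[of 1 x] by (simp add: fun_eq_iff)
    then show ?thesis by (simp add: F_def)
  qed
  have add: "m (x + y) = m x + m y" for x y using sup msub by (rule antisym[rotated])
  have neg: "m (- x) = - m x" for x
    using add[of x "- x"] sublinear_zero[OF m] by simp
  have "m (t *\<^sub>R x) = t * m x" for t x
  proof (cases "t \<ge> 0")
    case False
    then have "m ((- t) *\<^sub>R x) = (- t) * m x" by (intro mhom) simp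
    then show ?thesis using neg[of "t *\<^sub>R x"] by simp
  qed (rule mhom)
  then have "linear m" using add by (intro linearI) auto
  then show ?thesis using mp by blast
qed

text \<open>
  With \<open>r\<close> a lower bound for the distance from \<open>x\<close> to \<open>K\<close>, the infimum of \<open>norm (z + t (k - x)) - t r\<close>
  over \<open>t \<ge> 0\<close> and \<open>k\<close> in \<open>K\<close> is sublinear: convexity of \<open>K\<close> makes the vectors \<open>t (k - x)\<close> a cone
  closed under addition. A linear functional below it is bounded by the norm (take \<open>t = 0\<close>) and is at
  most \<open>- r\<close> at \<open>x - k\<close> (take \<open>t = 1\<close>).
\<close>

lemma closed_convex_separation:
  fixes K :: "'a::real_normed_vector set"
  assumes "closed K" "convex K" "x \<notin> K"
  shows "\<exists>(f :: 'a \<Rightarrow> real) r. bounded_linear f \<and> r > 0 \<and> (\<forall>k\<in>K. f x + r \<le> f k)"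
proof (cases "K = {}")
  case True
  then show ?thesis by (intro exI[of _ "\<lambda>_. 0"] exI[of _ "1::real"]) auto
next
  case False
  obtain r where r: "r > 0" and far: "\<And>k. k \<in> K \<Longrightarrow> r \<le> norm (k - x)"
  proof -
    obtain r where "r > 0" "ball x r \<subseteq> - K"
      using assms by (metis ComplI open_Compl open_contains_ball)
    then show ?thesis using that by (force simp: dist_norm norm_minus_commute)
  qed
  define I where "I = {0::real..} \<times> K"
  define F where "F = (\<lambda>(t, k) z. norm (z + t *\<^sub>R (k - x)) - t * r)"
  have ge: "- norm z \<le> F i z" if "i \<in> I" for i z
  proof -
    obtain t k where i: "i = (t, k)" "t \<ge> 0" "k \<in> K" using \<open>i \<in> I\<close> by (cases i) (auto simp: I_def)
    have "t * r \<le> t * norm (k - x)" using far i by (intro mult_left_mono)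
    also have "\<dots> = norm ((z + t *\<^sub>R (k - x)) - z)" using i by simp
    also have "\<dots> \<le> norm (z + t *\<^sub>R (k - x)) + norm z" by (rule norm_triangle_ineq4)
    finally show ?thesis by (simp add: F_def i)
  qed
  have bdd: "bdd_below ((\<lambda>i. F i z) ` I)" for z
    using ge by (rule bdd_belowI2)
  have "sublinear (\<lambda>z. INF i\<in>I. F i z)"
  proof (rule sublinear_INF[OF _ bdd])
    show "I \<noteq> {}" using False by (auto simp: I_def)
    show "\<exists>j\<in>I. F j (t *\<^sub>R z) \<le> t * F i z" if "i \<in> I" "t > 0" for i t z
    proof -
      obtain s k where i: "i = (s, k)" "s \<ge> 0" "k \<in> K" using \<open>i \<in> I\<close> by (cases i) (auto simp: I_def)
      have "norm (t *\<^sub>R z + (t * s) *\<^sub>R (k - x)) = norm (t *\<^sub>R (z + s *\<^sub>R (k - x)))"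
        by (simp add: scaleR_add_right)
      also have "\<dots> = t * norm (z + s *\<^sub>R (k - x))" using that by simp
      finally show ?thesis using i that
        by (intro bexI[of _ "(t * s, k)"]) (auto simp: F_def I_def right_diff_distrib)
    qed
    show "\<exists>k\<in>I. F k (z + w) \<le> F i z + F j w" if "i \<in> I" "j \<in> I" for i j z w
    proof -
      obtain s k where i: "i = (s, k)" "s \<ge> 0" "k \<in> K" using \<open>i \<in> I\<close> by (cases i) (auto simp: I_def)
      obtain t l where j: "j = (t, l)" "t \<ge> 0" "l \<in> K" using \<open>j \<in> I\<close> by (cases j) (auto simp: I_def)
      show ?thesis
      proof (cases "s + t = 0")
        case True
        then have "s = 0" "t = 0" using i j by auto
        then show ?thesis using i j norm_triangle_ineq[of z w]
          by (intro bexI[of _ "(0, k)"]) (auto simp: F_def I_def)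
      next
        case F: False
        then have st: "s + t > 0" using i j by simp
        define c where "c = (s / (s + t)) *\<^sub>R k + (t / (s + t)) *\<^sub>R l"
        have c: "c \<in> K" unfolding c_def using assms(2) i j st
          by (intro convexD) (auto simp flip: add_divide_distrib)
        have "(s + t) *\<^sub>R c = s *\<^sub>R k + t *\<^sub>R l"
          using F by (simp add: c_def scaleR_add_right)
        then have "(z + w) + (s + t) *\<^sub>R (c - x) = (z + s *\<^sub>R (k - x)) + (w + t *\<^sub>R (l - x))"
          by (simp add: algebra_simps)
        then have "norm ((z + w) + (s + t) *\<^sub>R (c - x)) \<le> norm (z + s *\<^sub>R (k - x)) + norm (w + t *\<^sub>R (l - x))"
          using norm_triangle_ineq by metis
        then show ?thesis using i j c
          by (intro bexI[of _ "(s + t, c)"]) (auto simp: F_def I_def algebra_simps)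
      qed
    qed
    show "0 \<le> F i 0" if "i \<in> I" for i using ge[OF that, of 0] by simp
    obtain k where "k \<in> K" using False by blast
    then show "\<exists>i\<in>I. F i 0 \<le> 0" by (intro bexI[of _ "(0, k)"]) (auto simp: F_def I_def)
  qed
  then obtain f where f: "linear f" and fF: "\<And>z. f z \<le> (INF i\<in>I. F i z)"
    using linear_below_sublinear by blast
  have low: "f z \<le> F i z" if "i \<in> I" for i z
    using fF[of z] cINF_lower[OF bdd[of z] that] by linarith
  have fn: "f z \<le> norm z" for z
    using low[of "(0, SOME k. k \<in> K)" z] False by (auto simp: I_def F_def some_in_eq)
  have "\<bar>f z\<bar> \<le> norm z" for z
    using fn[of z] fn[of "- z"] linear_neg[OF f, of z] by simp
  then have "bounded_linear f"
    using f by (intro bounded_linear_intro[of f 1]) (auto simp: linear_add linear_cmul)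
  moreover have "f x + r \<le> f k" if "k \<in> K" for k
  proof -
    have "f (x - k) \<le> F (1, k) (x - k)" by (rule low) (use that in \<open>auto simp: I_def\<close>)
    then show ?thesis by (simp add: F_def linear_diff[OF f])
  qed
  ultimately show ?thesis using r by blast
qed

section \<open>Weakly compact convex sets\<close>

lemma openin_weak_vimage:
  assumes "bounded_linear f" "open (U :: real set)"
  shows "openin (weak_topology (norm :: 'a::real_normed_vector \<Rightarrow> real)) (f -` U)"
  unfolding weak_topology_norm by (rule topology_generated_by_Basis) (use assms in blast)

lemma continuous_map_into_weak:
  fixes g :: "'b \<Rightarrow> 'a::real_normed_vector"
  assumes "\<And>f. bounded_linear f \<Longrightarrow> continuous_map X euclideanreal (\<lambda>x. f (g x))"
  shows "continuous_map X (weak_topology norm) g"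
  unfolding weak_topology_norm
proof (rule continuous_on_generated_topo)
  fix V assume "V \<in> {f -` U |(f :: 'a \<Rightarrow> real) U. bounded_linear f \<and> open U}"
  then obtain f and U :: "real set" where V: "V = f -` U" "bounded_linear f" "open U" by blast
  have "openin X {x \<in> topspace X. f (g x) \<in> U}"
    using openin_continuous_map_preimage[OF assms[OF V(2)]] V(3) by auto
  moreover have "g -` V \<inter> topspace X = {x \<in> topspace X. f (g x) \<in> U}" using V by auto
  ultimately show "openin X (g -` V \<inter> topspace X)" by simp
next
  have "UNIV \<in> {f -` U |(f :: 'a \<Rightarrow> real) U. bounded_linear f \<and> open U}"
    using bounded_linear_zero by (metis (mono_tags, lifting) mem_Collect_eq open_UNIV vimage_UNIV)
  then show "g ` topspace X \<subseteq> \<Union>{f -` U |(f :: 'a \<Rightarrow> real) U. bounded_linear f \<and> open U}"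
    by blast
qed

lemma continuous_map_weak_functional:
  assumes "bounded_linear (f :: 'a::real_normed_vector \<Rightarrow> real)"
  shows "continuous_map (weak_topology norm) euclideanreal f"
  unfolding continuous_map_def using openin_weak_vimage[OF assms]
  by (auto simp: topspace_weak_topology vimage_def)

lemma closedin_weak_of_closed_convex:
  fixes K :: "'a::real_normed_vector set"
  assumes "closed K" "convex K"
  shows "closedin (weak_topology norm) K"
  unfolding closedin_def topspace_weak_topology
proof
  show "openin (weak_topology norm) (UNIV - K)"
  proof (subst openin_subopen, intro ballI)
    fix x assume "x \<in> UNIV - K"
    then obtain f :: "'a \<Rightarrow> real" and r where f: "bounded_linear f" and r: "r > 0" and sep: "\<And>k. k \<in> K \<Longrightarrow> f x + r \<le> f k"
      using closed_convex_separation[OF assms, of x] by auto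
    have "openin (weak_topology norm) (f -` {..<f x + r})" by (rule openin_weak_vimage[OF f]) simp
    moreover have "f -` {..<f x + r} \<subseteq> UNIV - K" using sep by force
    ultimately show "\<exists>T. openin (weak_topology norm) T \<and> x \<in> T \<and> T \<subseteq> UNIV - K"
      using r by (intro exI[of _ "f -` {..<f x + r}"]) auto
  qed
qed simp

lemma Hausdorff_weak: "Hausdorff_space (weak_topology (norm :: 'a::real_normed_vector \<Rightarrow> real))"
  unfolding Hausdorff_space_def topspace_weak_topology
proof (intro allI impI, elim conjE)
  fix x y :: 'a assume "x \<noteq> y"
  then obtain f :: "'a \<Rightarrow> real" and r where f: "bounded_linear f" and r: "r > 0" and sep: "f x + r \<le> f y"
    using closed_convex_separation[of "{y}" x] by auto
  have 1: "openin (weak_topology norm) (f -` {..<f x + r/2})" by (rule openin_weak_vimage[OF f]) simp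
  have 2: "openin (weak_topology norm) (f -` {f x + r/2<..})" by (rule openin_weak_vimage[OF f]) simp
  show "\<exists>U V. openin (weak_topology norm) U \<and> openin (weak_topology norm) V \<and> x \<in> U \<and> y \<in> V \<and> disjnt U V"
    using 1 2 r sep by (intro exI[of _ "f -` {..<f x + r/2}"] exI[of _ "f -` {f x + r/2<..}"])
      (auto simp: disjnt_iff)
qed

lemma weakly_compact_imp_closed:
  fixes C :: "'a::real_normed_vector set"
  assumes "compactin (weak_topology norm) C"
  shows "closed C"
proof -
  have "closedin (weak_topology norm) C"
    using Hausdorff_weak assms by (rule compactin_imp_closedin)
  moreover have "continuous_map euclidean (weak_topology norm) (\<lambda>x::'a. x)"
    by (rule continuous_map_into_weak) (simp add: linear_continuous_on)
  ultimately have "closedin euclidean {x \<in> topspace euclidean. x \<in> C}"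
    using closedin_continuous_map_preimage by blast
  then show ?thesis by simp
qed

lemma weakly_compact_fip:
  fixes C :: "'a::real_normed_vector set"
  assumes C: "compactin (weak_topology norm) C"
    and sets: "\<And>K. K \<in> \<K> \<Longrightarrow> closed K \<and> convex K"
    and fip: "\<And>\<F>. finite \<F> \<Longrightarrow> \<F> \<subseteq> \<K> \<Longrightarrow> C \<inter> \<Inter>\<F> \<noteq> {}"
  shows "C \<inter> \<Inter>\<K> \<noteq> {}"
proof -
  have "\<forall>K\<in>\<K>. closedin (weak_topology norm) K"
    using sets closedin_weak_of_closed_convex by auto
  then show ?thesis using C fip unfolding compactin_fip by (metis (no_types, lifting))
qed

lemma weakly_compact_nested:
  fixes C :: "'a::real_normed_vector set"
  assumes C: "compactin (weak_topology norm) C"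
    and sets: "\<And>n::nat. closed (K n) \<and> convex (K n) \<and> K n \<noteq> {} \<and> K n \<subseteq> C"
    and dec: "\<And>m n. m \<le> n \<Longrightarrow> K n \<subseteq> K m"
  shows "\<exists>x\<in>C. \<forall>n. x \<in> K n"
proof -
  have "C \<inter> \<Inter>(range K) \<noteq> {}"
  proof (rule weakly_compact_fip[OF C])
    show "closed L \<and> convex L" if "L \<in> range K" for L using that sets by blast
    fix \<F> assume F: "finite \<F>" "\<F> \<subseteq> range K"
    then obtain I where I: "finite I" "\<F> = K ` I" by (meson finite_subset_image)
    have "K (Max (insert 0 I)) \<subseteq> K i" if "i \<in> I" for i using I that by (intro dec) auto
    then have "K (Max (insert 0 I)) \<subseteq> C \<inter> \<Inter>\<F>" using I sets by auto
    then show "C \<inter> \<Inter>\<F> \<noteq> {}" using sets by blast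
  qed
  then show ?thesis by blast
qed

text \<open>
  By Baire's theorem for the compact Hausdorff space \<open>C\<close>, one of the weakly closed sets
  \<open>C \<inter> cball 0 n\<close> contains a relatively weakly open set \<open>U \<inter> C\<close> around a point \<open>c0\<close>. Each point of \<open>C\<close>
  is moved into \<open>U\<close> by a contraction towards \<open>c0\<close> with factor \<open>1 / Suc k\<close> for some \<open>k\<close>, and by
  compactness finitely many of these factors serve all of \<open>C\<close>. Undoing the contractions bounds \<open>C\<close>.
\<close>

lemma weakly_compact_imp_bounded:
  fixes C :: "'a::real_normed_vector set"
  assumes C: "compactin (weak_topology norm) C" and conv: "convex C"
  shows "bounded C"
proof (cases "C = {}")
  case False
  define W where "W = weak_topology (norm :: 'a \<Rightarrow> real)"
  define X where "X = subtopology W C"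
  have topX: "topspace X = C" by (simp add: X_def W_def topspace_weak_topology)
  have cs: "compact_space X" using C by (simp add: X_def W_def compact_space_subtopology)
  have "Hausdorff_space X" unfolding X_def W_def by (rule Hausdorff_space_subtopology[OF Hausdorff_weak])
  then have reg: "regular_space X" using cs by (simp add: compact_Hausdorff_imp_regular_space)
  have loc: "locally_compact_space X" using cs by (rule compact_imp_locally_compact_space)
  define G where "G n = C \<inter> cball 0 (real n)" for n
  have clG: "closedin X (G n)" for n
  proof -
    have "closedin W (cball 0 (real n))"
      unfolding W_def by (rule closedin_weak_of_closed_convex) auto
    then show ?thesis unfolding X_def G_def closedin_subtopology by blast
  qed
  have "\<Union>(range G) = C" unfolding G_def using real_arch_simple by fastforce
  then have "X interior_of \<Union>(range G) \<noteq> {}"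
    using False topX by (metis interior_of_topspace)
  then have "\<not> (\<forall>T\<in>range G. closedin X T \<and> X interior_of T = {})"
    using Baire_category_alt[of X "range G"] loc reg by (metis countableI_type countable_image)
  then obtain n where "X interior_of (G n) \<noteq> {}" using clG by blast
  then obtain c0 V where V: "openin X V" "c0 \<in> V" "V \<subseteq> G n"
    unfolding interior_of_def by blast
  then obtain U where U: "openin W U" "V = U \<inter> C" unfolding X_def openin_subtopology by blast
  have c0: "c0 \<in> C" "c0 \<in> U" using V U by auto
  define g where "g k x = c0 + (1 / real (Suc k)) *\<^sub>R (x - c0)" for k :: nat and x
  have "continuous_map W W (g k)" for k
    unfolding W_def
  proof (rule continuous_map_into_weak)
    fix f :: "'a \<Rightarrow> real" assume f: "bounded_linear f"
    have "f (g k x) = f c0 + (1 / real (Suc k)) * (f x - f c0)" for x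
      unfolding g_def by (simp only: linear_add[OF bounded_linear.linear[OF f]] linear_cmul[OF bounded_linear.linear[OF f]] linear_diff[OF bounded_linear.linear[OF f]] real_scaleR_def)
    then show "continuous_map (weak_topology norm) euclideanreal (\<lambda>x. f (g k x))"
      by (simp only:) (intro continuous_intros continuous_map_weak_functional[OF f])
  qed
  then have opn: "openin W (g k -` U)" for k
    using openin_continuous_map_preimage[OF _ U(1), of W "g k"]
    by (simp add: W_def topspace_weak_topology vimage_def)
  have cov: "C \<subseteq> \<Union>(range (\<lambda>k. g k -` U))"
  proof
    fix x
    define l where "l t = c0 + t *\<^sub>R (x - c0)" for t :: real
    have "continuous_map euclideanreal W l" unfolding W_def
    proof (rule continuous_map_into_weak)
      fix f :: "'a \<Rightarrow> real" assume f: "bounded_linear f"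
      have "f (l t) = f c0 + t * (f x - f c0)" for t
        unfolding l_def by (simp only: linear_add[OF bounded_linear.linear[OF f]] linear_cmul[OF bounded_linear.linear[OF f]] linear_diff[OF bounded_linear.linear[OF f]] real_scaleR_def)
      then show "continuous_map euclideanreal euclideanreal (\<lambda>t. f (l t))"
        by (simp only:) (intro continuous_intros)
    qed
    then have "open (l -` U)" using openin_continuous_map_preimage[OF _ U(1), of euclideanreal l]
      by (simp add: vimage_def)
    moreover have "0 \<in> l -` U" using c0 by (simp add: l_def)
    moreover have "(\<lambda>k. 1 / real (Suc k)) \<longlonglongrightarrow> 0" using LIMSEQ_inverse_real_of_nat by (simp add: inverse_eq_divide)
    ultimately have "\<forall>\<^sub>F k in sequentially. 1 / real (Suc k) \<in> l -` U"
      using topological_tendstoD by blast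
    then obtain k where "1 / real (Suc k) \<in> l -` U" unfolding eventually_sequentially by blast
    then show "x \<in> \<Union>(range (\<lambda>k. g k -` U))" by (auto simp: g_def l_def)
  qed
  have "compactin W C" using C by (simp add: W_def)
  then obtain \<F> where \<F>: "finite \<F>" "\<F> \<subseteq> range (\<lambda>k. g k -` U)" "C \<subseteq> \<Union>\<F>"
    using compactinD[OF _ _ cov] opn by (metis (no_types, lifting) imageE)
  obtain I where "finite I" "\<F> = (\<lambda>k. g k -` U) ` I"
    using finite_subset_image[OF \<F>(1,2)] by blast
  then have I: "finite I" "C \<subseteq> (\<Union>k\<in>I. g k -` U)" using \<F>(3) by auto
  have bnd: "norm (x - c0) \<le> real (Suc k) * (real n + norm c0)" if "x \<in> C" "g k x \<in> U" for x k
  proof -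
    have "g k x = (1 - 1 / real (Suc k)) *\<^sub>R c0 + (1 / real (Suc k)) *\<^sub>R x"
      by (simp add: g_def algebra_simps)
    also have "\<dots> \<in> C" using conv c0 that by (intro convexD) auto
    finally have "g k x \<in> G n" using that U V by blast
    then have "norm (g k x) \<le> real n" by (simp add: G_def)
    then have "norm (g k x - c0) \<le> real n + norm c0" using norm_triangle_ineq4[of "g k x" c0] by linarith
    then have "norm (x - c0) / real (Suc k) \<le> real n + norm c0" by (simp add: g_def)
    then show ?thesis by (simp add: field_simps)
  qed
  have "C \<subseteq> (\<Union>k\<in>I. cball c0 (real (Suc k) * (real n + norm c0)))"
    using I(2) bnd by (force simp: dist_norm norm_minus_commute)
  moreover have "bounded (\<Union>k\<in>I. cball c0 (real (Suc k) * (real n + norm c0)))"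
    using I(1) by (intro bounded_UN) auto
  ultimately show ?thesis using bounded_subset by blast
qed simp

section \<open>Minimal invariant sets and the Goebel-Karlovitz lemma\<close>

lemma convexI_segment:
  "(\<And>x y t. x \<in> S \<Longrightarrow> y \<in> S \<Longrightarrow> 0 \<le> t \<Longrightarrow> t \<le> 1 \<Longrightarrow> (1 - t) *\<^sub>R x + t *\<^sub>R y \<in> S) \<Longrightarrow> convex S"
  by (simp add: convex_alt)

text \<open>
  The norm of the direct sum is not the norm of the product type but equivalent to it. So the topological
  notions of the type class apply unchanged, and only nonexpansiveness and distances refer to \<open>N\<close>.
\<close>

locale equivalent_norm =
  fixes N :: "'a::real_normed_vector \<Rightarrow> real" and \<alpha> \<beta> :: real
  assumes is_norm: "is_norm N" and alpha_pos: "0 < \<alpha>"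
    and lower: "\<alpha> * norm x \<le> N x" and upper: "N x \<le> \<beta> * norm x"
begin

lemma nonneg: "0 \<le> N x" using is_norm unfolding is_norm_def by blast
lemma zero [simp]: "N 0 = 0" using is_norm unfolding is_norm_def by blast
lemma scale: "N (c *\<^sub>R x) = \<bar>c\<bar> * N x" using is_norm unfolding is_norm_def by blast
lemma triangle: "N (x + y) \<le> N x + N y" using is_norm unfolding is_norm_def by blast
lemma minus_commute: "N (x - y) = N (y - x)" using scale[of "-1" "x - y"] by simp
lemma triangle3: "N (x - z) \<le> N (x - y) + N (y - z)" using triangle[of "x - y" "y - z"] by simp

lemma lipschitz: "\<bar>N x - N y\<bar> \<le> \<beta> * norm (x - y)"
  using triangle[of "x - y" y] triangle[of "y - x" x] upper[of "x - y"] minus_commute[of x y] by auto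

lemma continuous: "continuous_on S N"
proof -
  have "isCont N x" for x
  proof -
    have "((\<lambda>y. \<beta> * norm (y - x)) \<longlongrightarrow> \<beta> * norm (x - x)) (at x)" by (intro tendsto_intros)
    then have "((\<lambda>y. \<beta> * norm (y - x)) \<longlongrightarrow> 0) (at x)" by simp
    then have "((\<lambda>y. N y - N x) \<longlongrightarrow> 0) (at x)"
      by (rule Lim_null_comparison[rotated]) (simp add: lipschitz)
    then show ?thesis unfolding isCont_def using LIM_zero_cancel by blast
  qed
  then show ?thesis by (simp add: continuous_at_imp_continuous_on)
qed

lemma continuous_intro [continuous_intros]:
  "continuous_on S f \<Longrightarrow> continuous_on S (\<lambda>x. N (f x))"
  using continuous continuous_on_compose2 by blast

lemma convex_comb: "0 \<le> t \<Longrightarrow> t \<le> 1 \<Longrightarrow> N ((1 - t) *\<^sub>R x + t *\<^sub>R y - z) \<le> (1 - t) * N (x - z) + t * N (y - z)"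
proof -
  assume t: "0 \<le> t" "t \<le> 1"
  have "(1 - t) *\<^sub>R x + t *\<^sub>R y - z = (1 - t) *\<^sub>R (x - z) + t *\<^sub>R (y - z)"
    by (simp add: algebra_simps)
  then show ?thesis using triangle[of "(1 - t) *\<^sub>R (x - z)" "t *\<^sub>R (y - z)"] t by (simp add: scale)
qed

lemma closed_ball: "closed {x. N (x - a) \<le> r}"
  by (intro closed_Collect_le continuous_intros)

lemma convex_ball: "convex {x. N (x - a) \<le> r}"
proof (rule convexI_segment)
  fix x y t assume "x \<in> {x. N (x - a) \<le> r}" "y \<in> {x. N (x - a) \<le> r}" and t: "0 \<le> t" "t \<le> (1::real)"
  then have "(1 - t) * N (x - a) \<le> (1 - t) * r" "t * N (y - a) \<le> t * r" by (auto intro: mult_left_mono)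
  then have "N ((1 - t) *\<^sub>R x + t *\<^sub>R y - a) \<le> r"
    using convex_comb[OF t, of x y a] by (simp add: algebra_simps)
  then show "(1 - t) *\<^sub>R x + t *\<^sub>R y \<in> {x. N (x - a) \<le> r}" by simp
qed

lemma dual_functionals_eq: "dual_functionals N = dual_functionals norm"
proof -
  have "(\<exists>K. \<forall>x. \<bar>f x\<bar> \<le> K * N x) \<longleftrightarrow> (\<exists>K. \<forall>x. \<bar>f x\<bar> \<le> K * norm x)" for f :: "'a \<Rightarrow> real"
  proof
    assume "\<exists>K. \<forall>x. \<bar>f x\<bar> \<le> K * N x"
    then obtain K where K: "\<And>x. \<bar>f x\<bar> \<le> K * N x" by blast
    have "\<bar>f x\<bar> \<le> (max K 0 * \<beta>) * norm x" for x
    proof -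
      have "\<bar>f x\<bar> \<le> max K 0 * N x" using K[of x] nonneg[of x]
        by (meson max.cobounded1 mult_right_mono order_trans)
      also have "\<dots> \<le> max K 0 * (\<beta> * norm x)" using upper by (intro mult_left_mono) auto
      finally show ?thesis by (simp add: mult.assoc)
    qed
    then show "\<exists>K. \<forall>x. \<bar>f x\<bar> \<le> K * norm x" by blast
  next
    assume "\<exists>K. \<forall>x. \<bar>f x\<bar> \<le> K * norm x"
    then obtain K where K: "\<And>x. \<bar>f x\<bar> \<le> K * norm x" by blast
    have "\<bar>f x\<bar> \<le> (max K 0 / \<alpha>) * N x" for x
    proof -
      have "\<bar>f x\<bar> \<le> max K 0 * norm x" using K[of x]
        by (meson max.cobounded1 mult_right_mono norm_ge_zero order_trans)
      also have "\<dots> \<le> max K 0 * (N x / \<alpha>)"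
        using lower[of x] alpha_pos by (intro mult_left_mono) (auto simp: field_simps)
      finally show ?thesis by (simp add: mult.assoc)
    qed
    then show "\<exists>K. \<forall>x. \<bar>f x\<bar> \<le> K * N x" by blast
  qed
  then show ?thesis unfolding dual_functionals_def by simp
qed

text \<open>
  The weak topology depends only on which functionals are bounded, so equivalent norms share it.
\<close>

lemma weak_topology_eq: "weak_topology N = weak_topology norm"
  unfolding weak_topology_def dual_functionals_eq ..

end

definition minimal_invariant :: "('a::real_normed_vector \<Rightarrow> 'a) \<Rightarrow> 'a set \<Rightarrow> bool" where
  "minimal_invariant T C \<longleftrightarrow> C \<noteq> {} \<and> closed C \<and> convex C \<and> T \<in> C \<rightarrow> C \<and>
     (\<forall>K\<subseteq>C. K \<noteq> {} \<and> closed K \<and> convex K \<and> T \<in> K \<rightarrow> K \<longrightarrow> K = C)"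

lemma minimal_invariantD:
  "minimal_invariant T C \<Longrightarrow> K \<subseteq> C \<Longrightarrow> K \<noteq> {} \<Longrightarrow> closed K \<Longrightarrow> convex K \<Longrightarrow> T \<in> K \<rightarrow> K \<Longrightarrow> K = C"
  unfolding minimal_invariant_def by blast

text \<open>
  Closed convex sets are weakly closed, so weak compactness makes the intersection of a chain of nonempty
  closed convex invariant sets nonempty; Zorn's lemma then gives a minimal one.
\<close>

lemma minimal_invariant_exists:
  fixes C :: "'a::real_normed_vector set"
  assumes C: "compactin (weak_topology norm) C" "C \<noteq> {}" "convex C" "T \<in> C \<rightarrow> C"
  shows "\<exists>K\<subseteq>C. minimal_invariant T K"
proof -
  define A where "A = {K. K \<subseteq> C \<and> K \<noteq> {} \<and> closed K \<and> convex K \<and> T \<in> K \<rightarrow> K}"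
  have "\<exists>M\<in>A. \<forall>K\<in>A. K \<subseteq> M \<longrightarrow> K = M"
  proof (rule predicate_Zorn)
    show "partial_order_on A (relation_of (\<lambda>M K. K \<subseteq> M) A)"
      by (rule partial_order_on_relation_ofI) auto
    fix Q assume Q: "Q \<in> Chains (relation_of (\<lambda>M K. K \<subseteq> M) A)"
    then have QA: "Q \<subseteq> A" and ch: "\<And>K L. K \<in> Q \<Longrightarrow> L \<in> Q \<Longrightarrow> L \<subseteq> K \<or> K \<subseteq> L"
      by (auto simp: Chains_def relation_of_def)
    have "C \<inter> \<Inter>Q \<noteq> {}"
    proof (rule weakly_compact_fip[OF C(1)])
      show "closed K \<and> convex K" if "K \<in> Q" for K using that QA by (auto simp: A_def)
      fix \<F> assume F: "finite \<F>" "\<F> \<subseteq> Q"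
      have "\<F> = {} \<or> (\<exists>L\<in>\<F>. \<forall>K\<in>\<F>. L \<subseteq> K)"
        using F
      proof (induction rule: finite_induct)
        case (insert K \<F>)
        show ?case
        proof (cases "\<F> = {}")
          case False
          with insert obtain L where L: "L \<in> \<F>" "\<forall>K\<in>\<F>. L \<subseteq> K" by auto
          then have "K \<subseteq> L \<or> L \<subseteq> K" using ch insert.prems by auto
          then show ?thesis
          proof
            assume "K \<subseteq> L"
            then have "\<forall>M\<in>insert K \<F>. K \<subseteq> M" using L by auto
            then show ?thesis by blast
          next
            assume "L \<subseteq> K"
            then have "\<forall>M\<in>insert K \<F>. L \<subseteq> M" using L by auto
            then show ?thesis using L(1) by blast
          qed
        qed auto
      qed simp
      then show "C \<inter> \<Inter>\<F> \<noteq> {}"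
      proof
        assume "\<exists>L\<in>\<F>. \<forall>K\<in>\<F>. L \<subseteq> K"
        then obtain L where "L \<in> \<F>" "L \<subseteq> \<Inter>\<F>" by blast
        moreover from this have "L \<noteq> {}" "L \<subseteq> C" using F QA by (auto simp: A_def)
        ultimately show ?thesis by blast
      qed (use C in simp)
    qed
    moreover have "closed C" using C(1) by (rule weakly_compact_imp_closed)
    ultimately have "C \<inter> \<Inter>Q \<in> A"
      using C(3,4) QA unfolding A_def
      by (auto intro!: closed_Int closed_Inter convex_Int convex_Inter simp: Pi_iff subset_iff)
    then show "\<exists>u\<in>A. \<forall>a\<in>Q. u \<subseteq> a" by (rule bexI[rotated]) auto
  qed
  then obtain M where "M \<in> A" "\<And>K. K \<in> A \<Longrightarrow> K \<subseteq> M \<Longrightarrow> K = M" by blast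
  then have "M \<subseteq> C" "minimal_invariant T M" unfolding A_def minimal_invariant_def by auto
  then show ?thesis by auto
qed

context equivalent_norm begin

lemma bounded_dist:
  assumes "bounded C"
  shows "\<exists>D>0. \<forall>x\<in>C. \<forall>y\<in>C. N (x - y) \<le> D"
proof -
  obtain b where b: "\<And>x. x \<in> C \<Longrightarrow> norm x \<le> b" using assms unfolding bounded_iff by blast
  have "N (x - y) \<le> \<bar>\<beta>\<bar> * (b + b) + 1" if "x \<in> C" "y \<in> C" for x y
  proof -
    have "N (x - y) \<le> \<bar>\<beta>\<bar> * norm (x - y)"
      using upper[of "x - y"] by (meson abs_ge_self mult_right_mono norm_ge_zero order_trans)
    also have "\<dots> \<le> \<bar>\<beta>\<bar> * (b + b)"
      using b[OF that(1)] b[OF that(2)] norm_triangle_ineq4[of x y] by (intro mult_left_mono) auto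
    finally show ?thesis by simp
  qed
  then show ?thesis
    by (intro exI[of _ "max 1 (\<bar>\<beta>\<bar> * (b + b) + 1)"]) (auto simp: le_max_iff_disj)
qed

text \<open>
  The map \<open>S\<close> that mixes a small multiple of a constant into \<open>T\<close> is a strict contraction uniformly close
  to \<open>T\<close>. A late iterate of \<open>S\<close> is moved very little by \<open>S\<close>, hence also little by \<open>T\<close>.
\<close>

lemma approximate_fixed_point:
  assumes C: "C \<noteq> {}" "convex C" "bounded C" and T: "T \<in> C \<rightarrow> C" "nonexpansive_on N C T"
    and e: "0 < e"
  shows "\<exists>z\<in>C. N (T z - z) \<le> e"
proof -
  obtain x0 where x0: "x0 \<in> C" using C by blast
  obtain D where D: "D > 0" "\<And>x y. x \<in> C \<Longrightarrow> y \<in> C \<Longrightarrow> N (x - y) \<le> D"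
    using bounded_dist[OF C(3)] by blast
  define t where "t = min (1/2) (e / (2 * D))"
  have t: "0 < t" "t < 1" using e D by (auto simp: t_def)
  have tD: "t * D \<le> e / 2"
  proof -
    have "t * D \<le> (e / (2 * D)) * D" using D by (intro mult_right_mono) (auto simp: t_def)
    then show ?thesis using D by simp
  qed
  define S where "S z = (1 - t) *\<^sub>R T z + t *\<^sub>R x0" for z
  have SC: "S z \<in> C" if "z \<in> C" for z
    using convexD_alt[OF C(2), of "T z" x0 t] T(1) x0 t that by (auto simp: S_def)
  have contr: "N (S z - S w) \<le> (1 - t) * N (z - w)" if "z \<in> C" "w \<in> C" for z w
  proof -
    have "S z - S w = (1 - t) *\<^sub>R (T z - T w)" by (simp add: S_def algebra_simps)
    then have "N (S z - S w) = (1 - t) * N (T z - T w)" using t by (simp add: scale)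
    also have "\<dots> \<le> (1 - t) * N (z - w)"
      using T(2) that t unfolding nonexpansive_on_def by (intro mult_left_mono) auto
    finally show ?thesis .
  qed
  define z where "z k = (S ^^ k) x0" for k
  have zC: "z k \<in> C" for k by (induction k) (auto simp: z_def x0 SC)
  have step: "N (z (Suc k) - z k) \<le> (1 - t) ^ k * D" for k
  proof (induction k)
    case 0 show ?case using D(2)[OF zC[of 1] zC[of 0]] by simp
  next
    case (Suc k)
    have "N (z (Suc (Suc k)) - z (Suc k)) \<le> (1 - t) * N (z (Suc k) - z k)"
      using contr[OF zC[of "Suc k"] zC[of k]] by (simp add: z_def)
    also have "\<dots> \<le> (1 - t) * ((1 - t) ^ k * D)" using Suc t by (intro mult_left_mono) auto
    finally show ?case by simp
  qed
  \<comment> \<open>Then the step at \<open>z k\<close> is at most \<open>t * D\<close>, the same bound as for the distance of \<open>T\<close> and \<open>S\<close>.\<close>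
  obtain k where k: "(1 - t) ^ k < t" using real_arch_pow_inv[of t "1 - t"] t by auto
  have "N (T (z k) - S (z k)) \<le> t * D"
  proof -
    have "T (z k) - S (z k) = t *\<^sub>R (T (z k) - x0)" by (simp add: S_def algebra_simps)
    then show ?thesis using D(2)[of "T (z k)" x0] T(1) zC x0 t by (auto simp: scale intro!: mult_left_mono)
  qed
  moreover have "N (S (z k) - z k) \<le> t * D"
  proof -
    have "N (S (z k) - z k) \<le> (1 - t) ^ k * D" using step[of k] by (simp add: z_def)
    also have "\<dots> \<le> t * D" using k D by (intro mult_right_mono) auto
    finally show ?thesis .
  qed
  ultimately have "N (T (z k) - z k) \<le> e" using triangle3[of "T (z k)" "z k" "S (z k)"] tD by linarith
  then show ?thesis using zC by blast
qed

lemma approximate_fixed_point_sequence: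
  assumes C: "C \<noteq> {}" "convex C" "bounded C" and T: "T \<in> C \<rightarrow> C" "nonexpansive_on N C T"
  shows "\<exists>v. (\<forall>n. v n \<in> C) \<and> (\<lambda>n. N (T (v n) - v n)) \<longlonglongrightarrow> 0"
proof -
  have "\<forall>n::nat. \<exists>z\<in>C. N (T z - z) \<le> 1 / real (Suc n)"
    using approximate_fixed_point[OF assms] by auto
  then obtain v where v: "\<And>n. v n \<in> C" "\<And>n. N (T (v n) - v n) \<le> 1 / real (Suc n)" by metis
  have lim: "(\<lambda>n. 1 / real (Suc n)) \<longlonglongrightarrow> 0" using LIMSEQ_inverse_real_of_nat by (simp add: inverse_eq_divide)
  have "(\<lambda>n. N (T (v n) - v n)) \<longlonglongrightarrow> 0"
  proof (rule tendsto_sandwich[OF _ _ tendsto_const lim])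
    show "\<forall>\<^sub>F n in sequentially. 0 \<le> N (T (v n) - v n)" using nonneg by simp
    show "\<forall>\<^sub>F n in sequentially. N (T (v n) - v n) \<le> 1 / real (Suc n)" using v(2) by simp
  qed
  then show ?thesis using v by blast
qed

text \<open>
  The points of \<open>C\<close>
  within \<open>r\<close> of all of \<open>C\<close> form a closed convex set \<open>K\<close>. It is invariant because for \<open>z\<close> in \<open>K\<close> the part \<open>L\<close>
  of \<open>C\<close> within \<open>r\<close> of \<open>T z\<close> is invariant itself, hence all of \<open>C\<close>. By minimality
  \<open>K\<close>, which contains \<open>c\<close>, is \<open>C\<close>.
\<close>

lemma diametral_points:
  assumes min: "minimal_invariant T C" and T: "nonexpansive_on N C T"
    and c: "c \<in> C" "\<And>x. x \<in> C \<Longrightarrow> N (x - c) \<le> r" and xy: "x \<in> C" "y \<in> C"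
  shows "N (x - y) \<le> r"
proof -
  have C: "closed C" "convex C" "T \<in> C \<rightarrow> C" using min by (auto simp: minimal_invariant_def)
  have r: "0 \<le> r" using c by (metis diff_self zero)
  define K where "K = C \<inter> (\<Inter>x\<in>C. {z. N (z - x) \<le> r})"
  have "K = C"
  proof (rule minimal_invariantD[OF min])
    show "K \<noteq> {}" using c by (auto simp: K_def minus_commute)
    show "closed K" unfolding K_def using C closed_ball by (intro closed_Int closed_INT) auto
    show "convex K" unfolding K_def using C convex_ball by (intro convex_Int convex_INT) auto
    show "T \<in> K \<rightarrow> K"
    proof
      fix z assume z: "z \<in> K"
      define L where "L = C \<inter> {w. N (w - T z) \<le> r}"
      have "L = C"
      proof (rule minimal_invariantD[OF min])
        have "T z \<in> L" using z C(3) r by (auto simp: L_def K_def)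
        then show "L \<noteq> {}" by blast
        show "closed L" unfolding L_def using C closed_ball by (intro closed_Int) auto
        show "convex L" unfolding L_def using C convex_ball by (intro convex_Int) auto
        show "T \<in> L \<rightarrow> L"
        proof
          fix w assume w: "w \<in> L"
          have "N (T w - T z) \<le> N (w - z)"
            using T w z unfolding nonexpansive_on_def L_def K_def by blast
          also have "\<dots> \<le> r" using z w by (auto simp: K_def L_def minus_commute)
          finally show "T w \<in> L" using w C(3) by (auto simp: L_def)
        qed
      qed (auto simp: L_def)
      then show "T z \<in> K" using z C(3) unfolding K_def L_def by (auto simp: minus_commute)
    qed
  qed (auto simp: K_def)
  then show ?thesis using xy unfolding K_def by (auto simp: minus_commute)
qed

text \<open>
  The limit \<open>d\<close> is the diameter. Otherwise a subsequence stays at distance at most \<open>d - e\<close> from one point;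
  the set of points with this property in the limit is closed, convex and invariant, hence all of \<open>C\<close>.
  A weak cluster point of the subsequence is then within \<open>d - e/2\<close> of all of \<open>C\<close>, which contradicts
  \<open>diametral_points\<close>.
\<close>

theorem goebel_karlovitz:
  assumes weak: "compactin (weak_topology norm) C"
    and min: "minimal_invariant T C" and T: "nonexpansive_on N C T"
    and v: "\<And>n. v n \<in> C" "(\<lambda>n. N (T (v n) - v n)) \<longlonglongrightarrow> 0"
  shows "\<exists>d. \<forall>c\<in>C. (\<lambda>n. N (v n - c)) \<longlonglongrightarrow> d"
proof -
  have C: "closed C" "convex C" "T \<in> C \<rightarrow> C" "C \<noteq> {}" using min by (auto simp: minimal_invariant_def)
  obtain D where D: "D > 0" "\<And>x y. x \<in> C \<Longrightarrow> y \<in> C \<Longrightarrow> N (x - y) \<le> D"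
    using bounded_dist[OF weakly_compact_imp_bounded[OF weak C(2)]] by blast
  define d where "d = (SUP p\<in>C \<times> C. N (fst p - snd p))"
  have bdd: "bdd_above ((\<lambda>p. N (fst p - snd p)) ` (C \<times> C))"
    using D by (intro bdd_aboveI2[of _ _ D]) auto
  have le_d: "N (x - y) \<le> d" if "x \<in> C" "y \<in> C" for x y
    unfolding d_def using cSUP_upper[OF _ bdd, of "(x, y)"] that by simp
  have radius: "d \<le> r" if "c \<in> C" "\<And>x. x \<in> C \<Longrightarrow> N (x - c) \<le> r" for c r
    unfolding d_def using diametral_points[OF min T that] C(4) by (intro cSUP_least) auto
  have "(\<lambda>n. N (v n - c)) \<longlonglongrightarrow> d" if c: "c \<in> C" for c
  proof (rule ccontr)
    assume "\<not> (\<lambda>n. N (v n - c)) \<longlonglongrightarrow> d"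
    then obtain e where e: "e > 0" and "\<not> (\<forall>\<^sub>F n in sequentially. dist (N (v n - c)) d < e)"
      unfolding tendsto_iff by blast
    then have "infinite {n. \<not> dist (N (v n - c)) d < e}"
      unfolding cofinite_eq_sequentially[symmetric] eventually_cofinite by simp
    then obtain s :: "nat \<Rightarrow> nat" where s: "strict_mono s" "\<And>n. \<not> dist (N (v (s n) - c)) d < e"
      using infinite_enumerate by (metis (no_types, lifting) mem_Collect_eq)
    have far: "N (v (s n) - c) \<le> d - e" for n
      using s(2)[of n] le_d[OF v(1)[of "s n"] c] by (auto simp: dist_real_def)
    have afp: "(\<lambda>n. N (T (v (s n)) - v (s n))) \<longlonglongrightarrow> 0"
      using LIMSEQ_subseq_LIMSEQ[OF v(2) s(1)] by (simp add: o_def)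
    define K where "K = {x \<in> C. \<forall>h>0. \<forall>\<^sub>F n in sequentially. N (v (s n) - x) \<le> d - e + h}"
    have "K = C"
    proof (rule minimal_invariantD[OF min])
      have "c \<in> K" using c far unfolding K_def by (auto intro!: always_eventually order_trans[OF far])
      then show "K \<noteq> {}" by blast
      show "convex K"
      proof (rule convexI_segment)
        fix x y t assume x: "x \<in> K" and y: "y \<in> K" and t: "0 \<le> t" "t \<le> (1::real)"
        have "\<forall>\<^sub>F n in sequentially. N (v (s n) - ((1 - t) *\<^sub>R x + t *\<^sub>R y)) \<le> d - e + h" if "h > 0" for h
        proof -
          have "\<forall>\<^sub>F n in sequentially. N (v (s n) - x) \<le> d - e + h" "\<forall>\<^sub>F n in sequentially. N (v (s n) - y) \<le> d - e + h"
            using x y that by (auto simp: K_def)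
          then show ?thesis
          proof eventually_elim
            case (elim n)
            then have "x \<in> {x. N (x - v (s n)) \<le> d - e + h}" "y \<in> {x. N (x - v (s n)) \<le> d - e + h}"
              by (auto simp: minus_commute)
            from convexD_alt[OF convex_ball this t] show ?case by (simp add: minus_commute)
          qed
        qed
        moreover have "(1 - t) *\<^sub>R x + t *\<^sub>R y \<in> C" using convexD_alt[OF C(2) _ _ t] x y by (auto simp: K_def)
        ultimately show "(1 - t) *\<^sub>R x + t *\<^sub>R y \<in> K" by (simp add: K_def)
      qed
      show "closed K"
        unfolding closed_sequential_limits
      proof (intro allI impI, elim conjE)
        fix x l assume xK: "\<forall>n. x n \<in> K" and lim: "x \<longlonglongrightarrow> l"
        have "l \<in> C" using closed_sequentially[OF C(1)] xK lim by (auto simp: K_def)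
        moreover have "\<forall>\<^sub>F n in sequentially. N (v (s n) - l) \<le> d - e + h" if h: "h > 0" for h
        proof -
          have "(\<lambda>n. N (x n - l)) \<longlonglongrightarrow> N (l - l)"
            using continuous_on_tendsto_compose[OF continuous[of UNIV], of "\<lambda>n. x n - l" "l - l" sequentially]
              tendsto_diff[OF lim tendsto_const[of l]] by simp
          then have "\<forall>\<^sub>F n in sequentially. N (x n - l) < h/2" using h by (intro order_tendstoD) auto
          then obtain m where m: "N (x m - l) < h/2" unfolding eventually_sequentially by blast
          have "\<forall>\<^sub>F n in sequentially. N (v (s n) - x m) \<le> d - e + h/2" using xK h by (auto simp: K_def)
          then show ?thesis
          proof eventually_elim
            case (elim n)
            then show ?case using triangle3[of "v (s n)" l "x m"] m by linarith
          qed
        qed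
        ultimately show "l \<in> K" by (simp add: K_def)
      qed
      show "T \<in> K \<rightarrow> K"
      proof
        fix x assume x: "x \<in> K"
        have "\<forall>\<^sub>F n in sequentially. N (v (s n) - T x) \<le> d - e + h" if h: "h > 0" for h
        proof -
          have "\<forall>\<^sub>F n in sequentially. N (T (v (s n)) - v (s n)) < h/2"
            using afp h by (intro order_tendstoD) auto
          moreover have "\<forall>\<^sub>F n in sequentially. N (v (s n) - x) \<le> d - e + h/2" using x h by (auto simp: K_def)
          ultimately show ?thesis
          proof eventually_elim
            case (elim n)
            have "N (T (v (s n)) - T x) \<le> N (v (s n) - x)"
              using T v(1) x unfolding nonexpansive_on_def K_def by blast
            then show ?case using triangle3[of "v (s n)" "T x" "T (v (s n))"] elim
              by (simp add: minus_commute[of "v (s n)" "T (v (s n))"])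
          qed
        qed
        then show "T x \<in> K" using x C(3) by (auto simp: K_def)
      qed
    qed (auto simp: K_def)
    \<comment> \<open>A common point of the closed convex hulls of the tails replaces a weak limit.\<close>
    define L where "L m = closure (convex hull {v (s n) |n. m \<le> n})" for m
    have LC: "L m \<subseteq> C" for m
      unfolding L_def using C v by (intro closure_minimal hull_minimal) auto
    have "\<exists>w\<in>C. \<forall>m. w \<in> L m"
    proof (rule weakly_compact_nested[OF weak])
      show "closed (L m) \<and> convex (L m) \<and> L m \<noteq> {} \<and> L m \<subseteq> C" for m
        using LC[of m] by (auto simp: L_def convex_closure convex_convex_hull)
      show "L n \<subseteq> L m" if "m \<le> n" for m n
        unfolding L_def using that by (intro closure_mono hull_mono) auto
    qed
    then obtain w where w: "w \<in> C" "\<And>m. w \<in> L m" by blast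
    have "N (x - w) \<le> d - e/2" if "x \<in> C" for x
    proof -
      have "x \<in> K" using that \<open>K = C\<close> by simp
      moreover have "e/2 > 0" using e by simp
      ultimately have "\<forall>\<^sub>F n in sequentially. N (v (s n) - x) \<le> d - e + e/2" unfolding K_def by blast
      then obtain m where m: "\<And>n. m \<le> n \<Longrightarrow> N (v (s n) - x) \<le> d - e/2"
        unfolding eventually_sequentially by (auto simp: field_simps)
      have "L m \<subseteq> {y. N (y - x) \<le> d - e/2}"
        unfolding L_def using m by (intro closure_minimal hull_minimal closed_ball convex_ball) auto
      then show ?thesis using w(2)[of m] by (auto simp: minus_commute)
    qed
    then have "d \<le> d - e/2" using radius[OF w(1)] by blast
    then show False using e by simp
  qed
  then show ?thesis by blast
qed

end

section \<open>Uniform convexity in every direction\<close>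

text \<open>
  The differences of \<open>y n - p\<close> and \<open>y n - q\<close> all equal \<open>q - p\<close>, so directional uniform convexity pushes
  their midpoint inside the ball by a factor that does not depend on \<open>n\<close>.
\<close>

lemma uced_norm_limit_inj:
  fixes y :: "nat \<Rightarrow> 'b::real_normed_vector"
  assumes uced: "uniformly_convex_in_every_direction TYPE('b)"
    and p: "(\<lambda>n. norm (y n - p)) \<longlonglongrightarrow> b" and q: "(\<lambda>n. norm (y n - q)) \<longlonglongrightarrow> b"
    and m: "(\<lambda>n. norm (y n - (1/2) *\<^sub>R (p + q))) \<longlonglongrightarrow> b"
  shows "p = q"
proof (rule ccontr)
  assume "p \<noteq> q"
  define l where "l = norm (q - p)"
  have l: "l > 0" using \<open>p \<noteq> q\<close> by (simp add: l_def)
  have b0: "0 \<le> b" using p by (rule tendsto_lowerbound) auto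
  have b: "0 < b"
  proof -
    have "(\<lambda>n. norm (y n - p) + norm (y n - q)) \<longlonglongrightarrow> b + b" using p q by (rule tendsto_add)
    moreover have "l \<le> norm (y n - p) + norm (y n - q)" for n
      using norm_triangle_ineq4[of "y n - p" "y n - q"] by (simp add: l_def)
    ultimately have "l \<le> b + b" by (intro tendsto_lowerbound[where F = sequentially]) auto
    then show ?thesis using l by simp
  qed
  define \<epsilon> where "\<epsilon> = min 2 (l / (b + 1))"
  have "norm ((1 / l) *\<^sub>R (q - p)) = 1" "0 < \<epsilon>" "\<epsilon> \<le> 2" using l b by (auto simp: \<epsilon>_def l_def)
  then obtain \<delta> where \<delta>: "\<delta> > 0" and uc: "\<And>x y' k. norm x \<le> 1 \<Longrightarrow> norm y' \<le> 1 \<Longrightarrow>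
      x - y' = k *\<^sub>R ((1 / l) *\<^sub>R (q - p)) \<Longrightarrow> \<bar>k\<bar> \<ge> \<epsilon> \<Longrightarrow> norm ((1/2) *\<^sub>R (x + y')) \<le> 1 - \<delta>"
    using uced unfolding uniformly_convex_in_every_direction_def by metis
  \<comment> \<open>The radius \<open>R\<close> exceeds \<open>b\<close>, so that eventually both points lie in its ball; \<open>R \<le> b + 1\<close> keeps the
    rescaled difference at least \<open>\<epsilon>\<close>, and \<open>R \<le> b (1 + \<delta>)\<close> makes \<open>(1 - \<delta>) R\<close> smaller than \<open>b\<close>.\<close>
  define R where "R = min (b + 1) (b * (1 + \<delta>))"
  have R: "b < R" "0 < R" "R \<le> b + 1" using b \<delta> by (auto simp: R_def)
  have "\<forall>\<^sub>F n in sequentially. norm (y n - (1/2) *\<^sub>R (p + q)) \<le> (1 - \<delta>) * R"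
    using order_tendstoD(2)[OF p R(1)] order_tendstoD(2)[OF q R(1)]
  proof eventually_elim
    case (elim n)
    have "norm ((1/2) *\<^sub>R ((1/R) *\<^sub>R (y n - p) + (1/R) *\<^sub>R (y n - q))) \<le> 1 - \<delta>"
    proof (rule uc[where k = "l / R"])
      show "norm ((1/R) *\<^sub>R (y n - p)) \<le> 1" "norm ((1/R) *\<^sub>R (y n - q)) \<le> 1"
        using elim R by auto
      show "(1/R) *\<^sub>R (y n - p) - (1/R) *\<^sub>R (y n - q) = (l / R) *\<^sub>R ((1 / l) *\<^sub>R (q - p))"
        using l by (simp add: algebra_simps)
      have "l / (b + 1) \<le> l / R" using R l by (intro divide_left_mono) auto
      then show "\<epsilon> \<le> \<bar>l / R\<bar>" using l R by (auto simp: \<epsilon>_def)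
    qed
    moreover have "(1/2) *\<^sub>R ((1/R) *\<^sub>R (y n - p) + (1/R) *\<^sub>R (y n - q)) = (1/R) *\<^sub>R (y n - (1/2) *\<^sub>R (p + q))"
    proof -
      have "y n - p + (y n - q) = 2 *\<^sub>R (y n - (1/2) *\<^sub>R (p + q))"
        by (simp add: algebra_simps scaleR_2)
      then show ?thesis by (simp flip: scaleR_add_right)
    qed
    ultimately have "norm (y n - (1/2) *\<^sub>R (p + q)) / R \<le> 1 - \<delta>" using R by simp
    then show ?case using R by (simp only: pos_divide_le_eq)
  qed
  then have le: "b \<le> (1 - \<delta>) * R" using m by (intro tendsto_upperbound[where F = sequentially]) auto
  show False
  proof (cases "\<delta> \<le> 1")
    case True
    have "(1 - \<delta>) * R \<le> (1 - \<delta>) * (b * (1 + \<delta>))" using True by (intro mult_left_mono) (auto simp: R_def)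
    also have "\<dots> = b - \<delta> * \<delta> * b" by (simp add: algebra_simps)
    also have "\<dots> < b" using \<delta> b by simp
    finally show False using le by simp
  next
    case False
    then have "(1 - \<delta>) * R < 0" using R by (simp add: mult_neg_pos)
    then show False using le b by simp
  qed
qed

text \<open>
  Two of the three points span a segment whose \<open>\<beta>\<close>-values include the \<open>\<beta>\<close>-value of the third. The point of
  the segment with that value is the third point by injectivity; the cases are which point lies between.
\<close>

lemma injective_affine_imp_collinear:
  fixes \<beta> :: "'b::real_vector \<Rightarrow> real"
  assumes Q: "convex Q"
    and aff: "\<And>x y t. x \<in> Q \<Longrightarrow> y \<in> Q \<Longrightarrow> 0 \<le> t \<Longrightarrow> t \<le> 1 \<Longrightarrow>
        \<beta> ((1 - t) *\<^sub>R x + t *\<^sub>R y) = (1 - t) * \<beta> x + t * \<beta> y"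
    and inj: "inj_on \<beta> Q"
    and pqr: "p \<in> Q" "q \<in> Q" "r \<in> Q" "p \<noteq> q"
  shows "\<exists>t. r = p + t *\<^sub>R (q - p)"
proof -
  have ne: "\<beta> p \<noteq> \<beta> q" using inj pqr by (auto dest: inj_onD)
  define t where "t = (\<beta> r - \<beta> p) / (\<beta> q - \<beta> p)"
  have \<beta>r: "\<beta> r = (1 - t) * \<beta> p + t * \<beta> q"
  proof -
    have "t * (\<beta> q - \<beta> p) = \<beta> r - \<beta> p" using ne by (simp add: t_def)
    then show ?thesis by (simp add: algebra_simps)
  qed
  have comb: "z = (1 - s) *\<^sub>R x + s *\<^sub>R y" if "x \<in> Q" "y \<in> Q" "z \<in> Q" "0 \<le> s" "s \<le> 1"
      "\<beta> z = (1 - s) * \<beta> x + s * \<beta> y" for x y z s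
    using inj_onD[OF inj, of z "(1 - s) *\<^sub>R x + s *\<^sub>R y"] aff[OF that(1,2,4,5)] that
      convexD_alt[OF Q that(1,2,4,5)] by simp
  consider "0 \<le> t \<and> t \<le> 1" | "t > 1" | "t < 0" by linarith
  then show ?thesis
  proof cases
    case 1
    then have "r = (1 - t) *\<^sub>R p + t *\<^sub>R q" using \<beta>r pqr by (intro comb) auto
    then show ?thesis by (intro exI[of _ t]) (simp add: algebra_simps)
  next
    case 2
    have "q = (1 - 1/t) *\<^sub>R p + (1/t) *\<^sub>R r"
      using 2 pqr \<beta>r by (intro comb) (auto simp: field_simps)
    then have "t *\<^sub>R q = t *\<^sub>R ((1 - 1/t) *\<^sub>R p + (1/t) *\<^sub>R r)" by simp
    also have "\<dots> = (t - 1) *\<^sub>R p + r"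
      using 2 by (simp add: scaleR_add_right right_diff_distrib)
    finally show ?thesis by (intro exI[of _ t]) (simp add: algebra_simps)
  next
    case 3
    define s where "s = 1 / (1 - t)"
    have s: "0 \<le> s" "s \<le> 1" "(1 - t) * s = 1" using 3 by (auto simp: s_def)
    have s': "(1 - t) * (1 - s) = - t" using s(3) by (simp add: algebra_simps)
    have "(1 - t) * ((1 - s) * \<beta> q + s * \<beta> r) = - t * \<beta> q + \<beta> r"
      using s(3) s' by (metis distrib_left mult.assoc mult_1)
    also have "\<dots> = (1 - t) * \<beta> p" by (simp add: \<beta>r)
    finally have "p = (1 - s) *\<^sub>R q + s *\<^sub>R r" using 3 s pqr by (intro comb) auto
    then have "(1 - t) *\<^sub>R p = (1 - t) *\<^sub>R ((1 - s) *\<^sub>R q + s *\<^sub>R r)" by simp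
    also have "\<dots> = (- t) *\<^sub>R q + r" by (simp only: scaleR_add_right scaleR_scaleR s(3) s') simp
    finally show ?thesis by (intro exI[of _ t]) (simp add: algebra_simps)
  qed
qed

text \<open>
  Along a subsequence the distances to the three points converge. The limit \<open>\<beta>\<close> of the distances is
  then defined and affine on a convex set \<open>P\<close> containing them, and two points with equal
  \<open>\<beta>\<close>-value have a midpoint with the same value, so that they coincide by \<open>uced_norm_limit_inj\<close>.
\<close>

lemma uced_asymptotically_affine_collinear:
  fixes y :: "nat \<Rightarrow> 'b::real_normed_vector"
  assumes uced: "uniformly_convex_in_every_direction TYPE('b)"
    and Q: "convex Q"
    and y: "bounded (range y)"
    and aff: "\<And>x x' t. x \<in> Q \<Longrightarrow> x' \<in> Q \<Longrightarrow> 0 \<le> t \<Longrightarrow> t \<le> 1 \<Longrightarrow>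
        (\<lambda>n. (1 - t) * norm (y n - x) + t * norm (y n - x') - norm (y n - ((1 - t) *\<^sub>R x + t *\<^sub>R x'))) \<longlonglongrightarrow> 0"
    and pqr: "p \<in> Q" "q \<in> Q" "r \<in> Q" "p \<noteq> q"
  shows "\<exists>t. r = p + t *\<^sub>R (q - p)"
proof -
  obtain b where b: "\<And>n. norm (y n) \<le> b" using y unfolding bounded_iff by blast
  define F where "F n = (norm (y n - p), norm (y n - q), norm (y n - r))" for n
  have "bounded (range F)"
  proof -
    have "range (\<lambda>n. norm (y n - x)) \<subseteq> {0..b + norm x}" for x
      using b norm_triangle_ineq4[of "y _" x] by (force intro: order_trans)
    then have "range F \<subseteq> {0..b + norm p} \<times> {0..b + norm q} \<times> {0..b + norm r}"
      unfolding F_def by blast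
    moreover have "bounded ({0..b + norm p} \<times> {0..b + norm q} \<times> {0..b + norm r})"
      by (intro bounded_Times bounded_closed_interval)
    ultimately show ?thesis using bounded_subset by blast
  qed
  then obtain L s where s: "strict_mono s" "(F \<circ> s) \<longlonglongrightarrow> L"
    using bounded_imp_convergent_subsequence by blast
  define P where "P = {x \<in> Q. convergent (\<lambda>n. norm (y (s n) - x))}"
  define \<beta> where "\<beta> x = lim (\<lambda>n. norm (y (s n) - x))" for x
  have lim: "(\<lambda>n. norm (y (s n) - x)) \<longlonglongrightarrow> \<beta> x" if "x \<in> P" for x
    using that by (simp add: P_def \<beta>_def convergent_LIMSEQ_iff)
  have step: "(\<lambda>n. norm (y (s n) - ((1 - t) *\<^sub>R x + t *\<^sub>R x'))) \<longlonglongrightarrow> (1 - t) * \<beta> x + t * \<beta> x'"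
    if "x \<in> P" "x' \<in> P" "0 \<le> t" "t \<le> 1" for x x' t
  proof -
    have "(\<lambda>n. (1 - t) * norm (y (s n) - x) + t * norm (y (s n) - x')
        - ((1 - t) * norm (y (s n) - x) + t * norm (y (s n) - x') - norm (y (s n) - ((1 - t) *\<^sub>R x + t *\<^sub>R x'))))
        \<longlonglongrightarrow> (1 - t) * \<beta> x + t * \<beta> x' - 0"
      using LIMSEQ_subseq_LIMSEQ[OF aff[of x x' t] s(1)] that lim
      by (intro tendsto_intros) (auto simp: o_def P_def)
    then show ?thesis by simp
  qed
  show ?thesis
  proof (rule injective_affine_imp_collinear[where Q = P and \<beta> = \<beta>])
    show "convex P"
    proof (rule convexI_segment)
      fix x x' t assume x: "x \<in> P" "x' \<in> P" "0 \<le> t" "t \<le> (1::real)"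
      then have "(1 - t) *\<^sub>R x + t *\<^sub>R x' \<in> Q" using convexD_alt[OF Q, of x x' t] by (simp add: P_def)
      then show "(1 - t) *\<^sub>R x + t *\<^sub>R x' \<in> P" using step[OF x] by (auto simp: P_def convergent_def)
    qed
    show "\<beta> ((1 - t) *\<^sub>R x + t *\<^sub>R x') = (1 - t) * \<beta> x + t * \<beta> x'"
      if "x \<in> P" "x' \<in> P" "0 \<le> t" "t \<le> 1" for x x' t
      using limI[OF step[OF that]] by (simp add: \<beta>_def)
    show "inj_on \<beta> P"
    proof (rule inj_onI)
      fix x x' assume x: "x \<in> P" "x' \<in> P" "\<beta> x = \<beta> x'"
      have "(\<lambda>n. norm (y (s n) - (1/2) *\<^sub>R (x + x'))) \<longlonglongrightarrow> \<beta> x"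
        using step[OF x(1,2), of "1/2"] x(3) by (simp add: scaleR_add_right)
      then show "x = x'" using uced_norm_limit_inj[OF uced lim[OF x(1)]] lim[OF x(2)] x(3) by simp
    qed
    have "(\<lambda>n. F (s n)) \<longlonglongrightarrow> L" using s(2) by (simp add: o_def)
    from tendsto_fst[OF this] tendsto_fst[OF tendsto_snd[OF this]] tendsto_snd[OF tendsto_snd[OF this]]
    show "p \<in> P" "q \<in> P" "r \<in> P" using pqr by (auto simp: P_def F_def o_def convergent_def)
  qed (fact pqr(4))
qed

text \<open>
  All of \<open>Q\<close>, and with it the sequence, lies on one line, where bounded sequences have convergent
  subsequences.
\<close>

lemma uced_convergent_subsequence:
  fixes y :: "nat \<Rightarrow> 'b::real_normed_vector"
  assumes uced: "uniformly_convex_in_every_direction TYPE('b)"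
    and Q: "convex Q" "\<And>n. y n \<in> Q"
    and y: "bounded (range y)"
    and aff: "\<And>x x' t. x \<in> Q \<Longrightarrow> x' \<in> Q \<Longrightarrow> 0 \<le> t \<Longrightarrow> t \<le> 1 \<Longrightarrow>
        (\<lambda>n. (1 - t) * norm (y n - x) + t * norm (y n - x') - norm (y n - ((1 - t) *\<^sub>R x + t *\<^sub>R x'))) \<longlonglongrightarrow> 0"
  shows "\<exists>s y0. strict_mono s \<and> (y \<circ> s) \<longlonglongrightarrow> y0"
proof (cases "\<exists>q\<in>Q. q \<noteq> y 0")
  case False
  then have "y \<circ> id = (\<lambda>_. y 0)" using Q(2) by (auto simp: fun_eq_iff)
  then have "strict_mono (id :: nat \<Rightarrow> nat) \<and> (y \<circ> id) \<longlonglongrightarrow> y 0"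
    by (simp only: tendsto_const strict_mono_id simp_thms)
  then show ?thesis by blast
next
  case True
  then obtain q where q: "q \<in> Q" "y 0 \<noteq> q" by blast
  have "\<forall>n. \<exists>t. y n = y 0 + t *\<^sub>R (q - y 0)"
    using uced_asymptotically_affine_collinear[OF uced Q(1) y aff Q(2) q(1) Q(2) q(2)] by blast
  then obtain t where t: "\<And>n. y n = y 0 + t n *\<^sub>R (q - y 0)" by metis
  obtain b where b: "\<And>n. norm (y n) \<le> b" using y unfolding bounded_iff by blast
  have "bounded (range t)"
    unfolding bounded_iff
  proof (intro exI ballI)
    fix x assume "x \<in> range t"
    then obtain n where n: "x = t n" by blast
    have "\<bar>t n\<bar> * norm (q - y 0) = norm (y n - y 0)" using t[of n] by (metis add_diff_cancel_left' norm_scaleR)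
    also have "\<dots> \<le> b + b" using norm_triangle_ineq4[of "y n" "y 0"] b[of n] b[of 0] by linarith
    finally show "norm x \<le> (b + b) / norm (q - y 0)" using q n by (simp add: field_simps)
  qed
  then obtain l s where s: "strict_mono s" "(t \<circ> s) \<longlonglongrightarrow> l"
    using bounded_imp_convergent_subsequence by blast
  have "(\<lambda>n. y 0 + (t \<circ> s) n *\<^sub>R (q - y 0)) \<longlonglongrightarrow> y 0 + l *\<^sub>R (q - y 0)"
    by (intro tendsto_intros s(2))
  moreover have "y \<circ> s = (\<lambda>n. y 0 + (t \<circ> s) n *\<^sub>R (q - y 0))"
    unfolding o_def by (rule ext) (rule t)
  ultimately have "(y \<circ> s) \<longlonglongrightarrow> y 0 + l *\<^sub>R (q - y 0)" by simp
  then show ?thesis using s(1) by blast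
qed

section \<open>Strict monotonicity and nonexpansive images of segments\<close>

lemma norm_components_le: "norm (fst p) \<le> norm p" "norm (snd p) \<le> norm p"
  by (metis norm_fst_le prod.collapse) (metis norm_snd_le prod.collapse)

context
  fixes nZ :: "real \<times> real \<Rightarrow> real"
  assumes nZ: "is_norm nZ" and mono: "strictly_monotone nZ"
begin

lemma direct_sum_equivalent_norm:
  "\<exists>\<alpha> \<beta>. equivalent_norm (direct_sum_norm nZ :: 'a::real_normed_vector \<times> 'b::real_normed_vector \<Rightarrow> real) \<alpha> \<beta>"
proof -
  note n = nZ[unfolded is_norm_def]
  let ?N = "direct_sum_norm nZ :: 'a \<times> 'b \<Rightarrow> real"
  have pos: "nZ (1, 0) > 0" "nZ (0, 1) > 0"
    using n by (simp_all add: order_less_le zero_prod_def)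
  have sc: "nZ (t, 0) = \<bar>t\<bar> * nZ (1, 0)" "nZ (0, t) = \<bar>t\<bar> * nZ (0, 1)" for t
  proof -
    have "nZ (t *\<^sub>R (1, 0)) = \<bar>t\<bar> * nZ (1, 0)" "nZ (t *\<^sub>R (0, 1)) = \<bar>t\<bar> * nZ (0, 1)"
      using n by blast+
    then show "nZ (t, 0) = \<bar>t\<bar> * nZ (1, 0)" "nZ (0, t) = \<bar>t\<bar> * nZ (0, 1)"
      by (simp_all only: scaleR_Pair scaleR_zero_right real_scaleR_def mult_1_right mult_zero_right)
  qed
  define m where "m = min (nZ (1, 0)) (nZ (0, 1))"
  have lo: "m / 2 * norm p \<le> ?N p" for p
  proof -
    obtain x y where p: "p = (x, y)" by (cases p)
    have "norm x * nZ (1, 0) \<le> ?N p" "norm y * nZ (0, 1) \<le> ?N p"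
      using strictly_monotone_mono[OF mono, of "norm x" "norm x" 0 "norm y"]
        strictly_monotone_mono[OF mono, of 0 "norm x" "norm y" "norm y"]
      by (simp_all add: p direct_sum_norm_def sc(1)[of "norm x"] sc(2)[of "norm y"])
    moreover have "norm x * m \<le> norm x * nZ (1, 0)" "norm y * m \<le> norm y * nZ (0, 1)"
      by (auto simp: m_def intro!: mult_left_mono)
    ultimately have "(norm x + norm y) * m \<le> 2 * ?N p" unfolding distrib_right by linarith
    moreover have "norm p * m \<le> (norm x + norm y) * m"
      using pos norm_Pair_le[of x y] unfolding p by (intro mult_right_mono) (auto simp: m_def)
    ultimately show ?thesis by (simp add: algebra_simps)
  qed
  have hi: "?N p \<le> (nZ (1, 0) + nZ (0, 1)) * norm p" for p
  proof -
    obtain x y where p: "p = (x, y)" by (cases p)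
    have "nZ ((norm x, 0) + (0, norm y)) \<le> nZ (norm x, 0) + nZ (0, norm y)" using n by blast
    then have "?N p \<le> norm x * nZ (1, 0) + norm y * nZ (0, 1)"
      by (simp add: p direct_sum_norm_def sc(1)[of "norm x"] sc(2)[of "norm y"])
    also have "\<dots> \<le> norm p * nZ (1, 0) + norm p * nZ (0, 1)"
      using pos norm_fst_le[of x y] norm_snd_le[of y x] unfolding p by (intro add_mono mult_right_mono) auto
    finally show ?thesis by (simp add: algebra_simps)
  qed
  have "equivalent_norm ?N (m / 2) (nZ (1, 0) + nZ (0, 1))"
  proof
    show "is_norm ?N" by (rule is_norm_direct_sum[OF nZ mono])
    show "0 < m / 2" using pos by (simp add: m_def)
  qed (fact lo hi)+
  then show ?thesis by blast
qed

text \<open>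
  Strict monotonicity in the second coordinate, made uniform by compactness of the square of side \<open>R\<close>: a
  pair that dominates \<open>(a, b)\<close> with almost the same norm has almost the same second coordinate.
\<close>

lemma strictly_monotone_modulus:
  assumes "0 < \<epsilon>"
  shows "\<exists>\<delta>>0. \<forall>a b A B. 0 \<le> a \<and> a \<le> A \<and> 0 \<le> b \<and> b \<le> B \<and> a \<le> R \<and> b \<le> R \<and>
           nZ (A, B) \<le> nZ (a, b) + \<delta> \<longrightarrow> B \<le> b + \<epsilon>"
proof -
  let ?N = "direct_sum_norm nZ :: real \<times> real \<Rightarrow> real"
  obtain \<alpha> \<beta> where "equivalent_norm ?N \<alpha> \<beta>" using direct_sum_equivalent_norm by blast
  then interpret equivalent_norm ?N \<alpha> \<beta> .
  define G where "G p = ?N (p + (0, \<epsilon>)) - ?N p" for p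
  define S where "S = {0..\<bar>R\<bar>} \<times> {0..\<bar>R\<bar>}"
  have "compact S" "S \<noteq> {}" unfolding S_def by (auto intro: compact_Times)
  moreover have "continuous_on S G" unfolding G_def by (intro continuous_intros)
  ultimately obtain p where p: "p \<in> S" and min: "\<And>q. q \<in> S \<Longrightarrow> G p \<le> G q"
    using continuous_attains_inf[of S G] by auto
  have Gpos: "G p > 0"
    using p assms mono by (cases p) (auto simp: G_def S_def direct_sum_norm_def strictly_monotone_def)
  have "B \<le> b + \<epsilon>" if H: "0 \<le> a" "a \<le> A" "0 \<le> b" "b \<le> B" "a \<le> R" "b \<le> R"
    "nZ (A, B) \<le> nZ (a, b) + G p / 2" for a b A B
  proof (rule ccontr)
    assume "\<not> B \<le> b + \<epsilon>"
    then have "nZ (a, b + \<epsilon>) \<le> nZ (A, B)" using H assms by (intro strictly_monotone_mono[OF mono]) auto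
    moreover have "G p \<le> nZ (a, b + \<epsilon>) - nZ (a, b)"
      using min[of "(a, b)"] H assms by (simp add: G_def S_def direct_sum_norm_def)
    ultimately show False using H(7) Gpos by simp
  qed
  then show ?thesis using Gpos by (intro exI[of _ "G p / 2"]) auto
qed

lemma direct_sum_triangle:
  fixes z v w :: "'a::real_normed_vector \<times> 'b::real_normed_vector"
  shows "nZ (norm (fst (z - v)) + norm (fst (z - w)), norm (snd (z - v)) + norm (snd (z - w)))
     \<le> direct_sum_norm nZ (z - v) + direct_sum_norm nZ (z - w)"
proof -
  have "nZ ((norm (fst (z - v)), norm (snd (z - v))) + (norm (fst (z - w)), norm (snd (z - w))))
    \<le> nZ (norm (fst (z - v)), norm (snd (z - v))) + nZ (norm (fst (z - w)), norm (snd (z - w)))"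
    using nZ unfolding is_norm_def by blast
  then show ?thesis by (simp add: direct_sum_norm_def case_prod_unfold)
qed

text \<open>
  Since \<open>v n\<close> is asymptotically equally far from \<open>c\<close>, from \<open>c'\<close> and from the point \<open>m\<close> between them, the
  convexity estimates for the two coordinate distances to \<open>m\<close> cannot lose anything in the limit, by
  strict monotonicity.
\<close>

lemma snd_dist_asymptotically_affine:
  fixes v :: "nat \<Rightarrow> 'a::real_normed_vector \<times> 'b::real_normed_vector"
  assumes C: "convex C" "bounded C" and v: "\<And>n. v n \<in> C"
    and dist: "\<And>c. c \<in> C \<Longrightarrow> (\<lambda>n. direct_sum_norm nZ (v n - c)) \<longlonglongrightarrow> d"
    and c: "c \<in> C" "c' \<in> C" and t: "0 \<le> t" "t \<le> 1"
  shows "(\<lambda>n. (1 - t) * norm (snd (v n) - snd c) + t * norm (snd (v n) - snd c')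
      - norm (snd (v n) - ((1 - t) *\<^sub>R snd c + t *\<^sub>R snd c'))) \<longlonglongrightarrow> 0"
proof -
  define m where "m = (1 - t) *\<^sub>R c + t *\<^sub>R c'"
  have m: "m \<in> C" unfolding m_def using convexD_alt[OF C(1) c t] .
  obtain b where b: "\<And>x. x \<in> C \<Longrightarrow> norm x \<le> b" using C(2) unfolding bounded_iff by blast
  define R where "R = b + b"
  have bnd: "norm (fst (v n - m)) \<le> R" "norm (snd (v n - m)) \<le> R" for n
  proof -
    have "norm (v n - m) \<le> R" unfolding R_def using norm_triangle_ineq4[of "v n" m] b[OF v[of n]] b[OF m] by linarith
    then show "norm (fst (v n - m)) \<le> R" "norm (snd (v n - m)) \<le> R"
      using norm_components_le[of "v n - m"] by linarith+
  qed
  define A where "A n = (1 - t) * norm (fst (v n - c)) + t * norm (fst (v n - c'))" for n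
  define B where "B n = (1 - t) * norm (snd (v n - c)) + t * norm (snd (v n - c'))" for n
  have split: "v n - m = (1 - t) *\<^sub>R (v n - c) + t *\<^sub>R (v n - c')" for n
    by (simp add: m_def algebra_simps)
  have leA: "norm (fst (v n - m)) \<le> A n" for n
    unfolding split A_def fst_add fst_scaleR using t norm_triangle_ineq[of "(1 - t) *\<^sub>R fst (v n - c)" "t *\<^sub>R fst (v n - c')"]
    by simp
  have leB: "norm (snd (v n - m)) \<le> B n" for n
    unfolding split B_def snd_add snd_scaleR using t norm_triangle_ineq[of "(1 - t) *\<^sub>R snd (v n - c)" "t *\<^sub>R snd (v n - c')"]
    by simp
  have NAB: "nZ (A n, B n) \<le> (1 - t) * direct_sum_norm nZ (v n - c) + t * direct_sum_norm nZ (v n - c')" for n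
  proof -
    have "nZ ((1 - t) *\<^sub>R (norm (fst (v n - c)), norm (snd (v n - c))) + t *\<^sub>R (norm (fst (v n - c')), norm (snd (v n - c'))))
      \<le> (1 - t) * nZ (norm (fst (v n - c)), norm (snd (v n - c))) + t * nZ (norm (fst (v n - c')), norm (snd (v n - c')))"
      using nZ t unfolding is_norm_def by (smt (verit))
    then show ?thesis by (simp add: A_def B_def direct_sum_norm_def case_prod_unfold)
  qed
  have Nm: "nZ (norm (fst (v n - m)), norm (snd (v n - m))) = direct_sum_norm nZ (v n - m)" for n
    by (simp add: direct_sum_norm_def case_prod_unfold)
  have "(\<lambda>n. B n - norm (snd (v n - m))) \<longlonglongrightarrow> 0"
  proof (rule tendstoI)
    fix e :: real assume "e > 0"
    then have "e / 2 > 0" by simp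
    from strictly_monotone_modulus[OF this, of R] obtain \<delta> where \<delta>: "\<delta> > 0"
      and mod: "\<And>a b A B. 0 \<le> a \<Longrightarrow> a \<le> A \<Longrightarrow> 0 \<le> b \<Longrightarrow> b \<le> B \<Longrightarrow> a \<le> R \<Longrightarrow> b \<le> R \<Longrightarrow>
           nZ (A, B) \<le> nZ (a, b) + \<delta> \<Longrightarrow> B \<le> b + e / 2" by blast
    have "(\<lambda>n. (1 - t) * direct_sum_norm nZ (v n - c) + t * direct_sum_norm nZ (v n - c')) \<longlonglongrightarrow> (1 - t) * d + t * d"
      by (intro tendsto_intros dist c)
    then have "(\<lambda>n. (1 - t) * direct_sum_norm nZ (v n - c) + t * direct_sum_norm nZ (v n - c')) \<longlonglongrightarrow> d"
      by (simp add: algebra_simps)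
    then have "\<forall>\<^sub>F n in sequentially. (1 - t) * direct_sum_norm nZ (v n - c) + t * direct_sum_norm nZ (v n - c') < d + \<delta> / 2"
      using \<delta> by (intro order_tendstoD) auto
    moreover have "\<forall>\<^sub>F n in sequentially. d - \<delta> / 2 < direct_sum_norm nZ (v n - m)"
      using dist[OF m] \<delta> by (intro order_tendstoD) auto
    ultimately show "\<forall>\<^sub>F n in sequentially. dist (B n - norm (snd (v n - m))) 0 < e"
    proof eventually_elim
      case (elim n)
      have "B n \<le> norm (snd (v n - m)) + e / 2"
        using NAB[of n] Nm[of n] elim
        by (intro mod[OF norm_ge_zero leA[of n] norm_ge_zero leB[of n] bnd(1)[of n] bnd(2)[of n]]) linarith
      then show ?case using leB[of n] \<open>e > 0\<close> by (simp add: dist_real_def)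
    qed
  qed
  then show ?thesis by (simp add: B_def m_def)
qed

text \<open>
  Here lies the reason why the second coordinate collapses. Let the height of a point be the distance of its
  second coordinate from \<open>y0\<close>. Asymptotically \<open>g\<close> fixes \<open>v n\<close>, and \<open>v n\<close> is as far from \<open>g e\<close> as from
  \<open>e\<close>. So for \<open>z\<close> on the segment from \<open>e\<close> to \<open>v n\<close> the image \<open>g z\<close> lies almost on a geodesic from
  \<open>g e\<close> to \<open>v n\<close>: the triangle inequality through \<open>g z\<close> is almost sharp in the sum norm, hence by strict
  monotonicity also in the second coordinate. As \<open>v n\<close> has height almost \<open>0\<close>, the point \<open>g z\<close> is
  hardly higher than \<open>g e\<close>. The comparison constant is \<open>1\<close>, so that errors merely add up when the lemma is
  applied repeatedly.
\<close>

lemma segment_height: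
  fixes v :: "nat \<Rightarrow> 'a::real_normed_vector \<times> 'b::real_normed_vector"
  assumes C: "convex C" "bounded C" and v: "\<And>n. v n \<in> C"
    and dist: "\<And>c. c \<in> C \<Longrightarrow> (\<lambda>n. direct_sum_norm nZ (v n - c)) \<longlonglongrightarrow> d"
    and y0: "(\<lambda>n. snd (v n)) \<longlonglongrightarrow> y0"
    and g: "g \<in> C \<rightarrow> C" "nonexpansive_on (direct_sum_norm nZ) C g"
      "(\<lambda>n. direct_sum_norm nZ (g (v n) - v n)) \<longlonglongrightarrow> 0"
    and e: "e \<in> C" and \<epsilon>: "0 < \<epsilon>"
  shows "\<forall>\<^sub>F n in sequentially. \<forall>t. 0 \<le> t \<and> t \<le> 1 \<longrightarrow>
     norm (snd (g ((1 - t) *\<^sub>R e + t *\<^sub>R v n)) - y0) \<le> norm (snd (g e) - y0) + \<epsilon>"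
proof -
  let ?N = "direct_sum_norm nZ :: 'a \<times> 'b \<Rightarrow> real"
  obtain \<alpha> \<beta> where "equivalent_norm ?N \<alpha> \<beta>" using direct_sum_equivalent_norm by blast
  then interpret equivalent_norm ?N \<alpha> \<beta> .
  have ge: "g e \<in> C" using g(1) e by blast
  obtain b where b: "\<And>x. x \<in> C \<Longrightarrow> norm x \<le> b" using C(2) unfolding bounded_iff by blast
  define R where "R = b + b"
  have bnd: "norm (fst (v n - g e)) \<le> R" "norm (snd (v n - g e)) \<le> R" for n
  proof -
    have "norm (v n - g e) \<le> R" unfolding R_def using norm_triangle_ineq4[of "v n" "g e"] b[OF v[of n]] b[OF ge] by linarith
    then show "norm (fst (v n - g e)) \<le> R" "norm (snd (v n - g e)) \<le> R"
      using norm_components_le[of "v n - g e"] by linarith+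
  qed
  have "\<epsilon> / 2 > 0" using \<epsilon> by simp
  from strictly_monotone_modulus[OF this, of R] obtain \<delta> where \<delta>: "\<delta> > 0"
    and mod: "\<And>a b A B. 0 \<le> a \<Longrightarrow> a \<le> A \<Longrightarrow> 0 \<le> b \<Longrightarrow> b \<le> B \<Longrightarrow> a \<le> R \<Longrightarrow> b \<le> R \<Longrightarrow>
         nZ (A, B) \<le> nZ (a, b) + \<delta> \<Longrightarrow> B \<le> b + \<epsilon> / 2" by blast
  have "\<forall>\<^sub>F n in sequentially. ?N (g (v n) - v n) < \<delta> / 3" using g(3) \<delta> by (intro order_tendstoD) auto
  moreover have "\<forall>\<^sub>F n in sequentially. ?N (v n - e) < d + \<delta> / 3" using dist[OF e] \<delta> by (intro order_tendstoD) auto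
  moreover have "\<forall>\<^sub>F n in sequentially. d - \<delta> / 3 < ?N (v n - g e)" using dist[OF ge] \<delta> by (intro order_tendstoD) auto
  moreover have "\<forall>\<^sub>F n in sequentially. dist (snd (v n)) y0 < \<epsilon> / 4"
    using y0 \<epsilon> by (intro tendstoD) auto
  ultimately show ?thesis
  proof eventually_elim
    case (elim n)
    show ?case
    proof (intro allI impI)
      fix t :: real assume t: "0 \<le> t \<and> t \<le> 1"
      define z where "z = (1 - t) *\<^sub>R e + t *\<^sub>R v n"
      have z: "z \<in> C" unfolding z_def using convexD_alt[OF C(1) e v] t by blast
      have zv: "z - v n = (1 - t) *\<^sub>R (e - v n)" and ze: "z - e = t *\<^sub>R (v n - e)"
        by (simp_all add: z_def algebra_simps)
      have "?N (z - v n) = (1 - t) * ?N (v n - e)" "?N (z - e) = t * ?N (v n - e)"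
        unfolding zv ze scale minus_commute[of e "v n"] using t by simp_all
      then have zlen: "?N (z - v n) + ?N (z - e) = ?N (v n - e)"
        by (simp add: left_diff_distrib)
      have "?N (g z - v n) \<le> ?N (z - v n) + ?N (g (v n) - v n)"
        using triangle3[of "g z" "v n" "g (v n)"] g(2) z v[of n] unfolding nonexpansive_on_def by fastforce
      moreover have "?N (g z - g e) \<le> ?N (z - e)"
        using g(2) z e unfolding nonexpansive_on_def by blast
      ultimately have "?N (g z - v n) + ?N (g z - g e) \<le> ?N (v n - g e) + \<delta>"
        using zlen elim by linarith
      then have key: "nZ (norm (fst (g z - v n)) + norm (fst (g z - g e)), norm (snd (g z - v n)) + norm (snd (g z - g e)))
        \<le> nZ (norm (fst (v n - g e)), norm (snd (v n - g e))) + \<delta>"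
        using direct_sum_triangle[of "g z" "v n" "g e"] by (simp add: direct_sum_norm_def case_prod_unfold)
      have tri: "norm (fst (v n - g e)) \<le> norm (fst (g z - v n)) + norm (fst (g z - g e))"
        "norm (snd (v n - g e)) \<le> norm (snd (g z - v n)) + norm (snd (g z - g e))"
        using norm_triangle_ineq4[of "fst (g z - g e)" "fst (g z - v n)"]
          norm_triangle_ineq4[of "snd (g z - g e)" "snd (g z - v n)"] by simp_all
      have "norm (snd (g z - v n)) + norm (snd (g z - g e)) \<le> norm (snd (v n - g e)) + \<epsilon> / 2"
        by (rule mod[OF norm_ge_zero tri(1) norm_ge_zero tri(2) bnd key])
      then have "norm (snd (g z) - snd (v n)) \<le> norm (snd (v n) - snd (g e)) + \<epsilon> / 2"
        using norm_ge_zero[of "snd (g z - g e)"] by (simp add: order_trans[rotated])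
      moreover have "norm (snd (v n) - y0) < \<epsilon> / 4" using elim(4) by (simp add: dist_norm)
      moreover have "norm (snd (g z) - y0) \<le> norm (snd (g z) - snd (v n)) + norm (snd (v n) - y0)"
        using norm_triangle_ineq[of "snd (g z) - snd (v n)" "snd (v n) - y0"] by simp
      moreover have "norm (snd (v n) - snd (g e)) \<le> norm (snd (g e) - y0) + norm (snd (v n) - y0)"
        using norm_triangle_ineq4[of "snd (v n) - y0" "snd (g e) - y0"] by simp
      ultimately have "norm (snd (g z) - y0) \<le> norm (snd (g e) - y0) + \<epsilon>" by linarith
      then show "norm (snd (g ((1 - t) *\<^sub>R e + t *\<^sub>R v n)) - y0) \<le> norm (snd (g e) - y0) + \<epsilon>"
        by (simp add: z_def)
    qed
  qed
qed

text \<open>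
  A finite net in \<open>S\<close> suffices, because \<open>g\<close> is Lipschitz for the norm of the product type as well.
\<close>

lemma segment_height_uniform:
  fixes v :: "nat \<Rightarrow> 'a::real_normed_vector \<times> 'b::real_normed_vector"
  assumes C: "convex C" "bounded C" and v: "\<And>n. v n \<in> C"
    and dist: "\<And>c. c \<in> C \<Longrightarrow> (\<lambda>n. direct_sum_norm nZ (v n - c)) \<longlonglongrightarrow> d"
    and y0: "(\<lambda>n. snd (v n)) \<longlonglongrightarrow> y0"
    and g: "g \<in> C \<rightarrow> C" "nonexpansive_on (direct_sum_norm nZ) C g"
      "(\<lambda>n. direct_sum_norm nZ (g (v n) - v n)) \<longlonglongrightarrow> 0"
    and S: "compact S" "S \<subseteq> C" and \<epsilon>: "0 < \<epsilon>"
  shows "\<forall>\<^sub>F n in sequentially. \<forall>e\<in>S. \<forall>t. 0 \<le> t \<and> t \<le> 1 \<longrightarrow>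
     norm (snd (g ((1 - t) *\<^sub>R e + t *\<^sub>R v n)) - y0) \<le> norm (snd (g e) - y0) + \<epsilon>"
proof -
  let ?N = "direct_sum_norm nZ :: 'a \<times> 'b \<Rightarrow> real"
  obtain \<alpha> \<beta> where "equivalent_norm ?N \<alpha> \<beta>" using direct_sum_equivalent_norm by blast
  then interpret equivalent_norm ?N \<alpha> \<beta> .
  define L where "L = \<bar>\<beta>\<bar> / \<alpha> + 1"
  have L: "L > 0" using alpha_pos by (auto simp: L_def intro: add_nonneg_pos)
  have lip: "norm (snd (g x) - snd (g z)) \<le> L * norm (x - z)" if "x \<in> C" "z \<in> C" for x z
  proof -
    have "\<alpha> * norm (snd (g x) - snd (g z)) \<le> \<alpha> * norm (g x - g z)"
      using norm_components_le(2)[of "g x - g z"] alpha_pos by simp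
    also have "\<dots> \<le> ?N (g x - g z)" by (rule lower)
    also have "\<dots> \<le> ?N (x - z)" using g(2) that unfolding nonexpansive_on_def by blast
    also have "\<dots> \<le> \<beta> * norm (x - z)" by (rule upper)
    also have "\<dots> \<le> \<bar>\<beta>\<bar> * norm (x - z)" by (intro mult_right_mono) auto
    finally have "norm (snd (g x) - snd (g z)) \<le> \<bar>\<beta>\<bar> / \<alpha> * norm (x - z)" using alpha_pos by (simp add: field_simps)
    then show ?thesis unfolding L_def distrib_right using norm_ge_zero[of "x - z"] by linarith
  qed
  define \<rho> where "\<rho> = \<epsilon> / (4 * L)"
  have \<rho>: "\<rho> > 0" "L * \<rho> = \<epsilon> / 4" using \<epsilon> L by (auto simp: \<rho>_def)
  obtain K where K: "finite K" "K \<subseteq> S" "S \<subseteq> (\<Union>x\<in>K. ball x \<rho>)"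
    using compactE_image[OF S(1), of S "\<lambda>x. ball x \<rho>"] \<rho> by force
  have "\<forall>\<^sub>F n in sequentially. \<forall>e\<in>K. \<forall>t. 0 \<le> t \<and> t \<le> 1 \<longrightarrow>
     norm (snd (g ((1 - t) *\<^sub>R e + t *\<^sub>R v n)) - y0) \<le> norm (snd (g e) - y0) + \<epsilon> / 2"
    using K S(2) \<epsilon> by (intro eventually_ball_finite ballI segment_height[OF C v dist y0 g]) auto
  then show ?thesis
  proof eventually_elim
    case (elim n)
    show ?case
    proof (intro ballI allI impI)
      fix e and t :: real assume e: "e \<in> S" and t: "0 \<le> t \<and> t \<le> 1"
      then obtain k where k: "k \<in> K" "norm (e - k) < \<rho>" using K(3) by (auto simp: dist_norm norm_minus_commute)
      have kC: "k \<in> C" and eC: "e \<in> C" using k(1) K(2) e S(2) by auto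
      define ze zk where "ze = (1 - t) *\<^sub>R e + t *\<^sub>R v n" and "zk = (1 - t) *\<^sub>R k + t *\<^sub>R v n"
      have zC: "ze \<in> C" "zk \<in> C" unfolding ze_def zk_def using convexD_alt[OF C(1)] eC kC v t by auto
      have "ze - zk = (1 - t) *\<^sub>R (e - k)" by (simp add: ze_def zk_def algebra_simps)
      then have "norm (ze - zk) = (1 - t) * norm (e - k)" using t by simp
      also have "\<dots> \<le> 1 * norm (e - k)" using t by (intro mult_right_mono) auto
      finally have "norm (ze - zk) \<le> \<rho>" using k(2) by simp
      then have "L * norm (ze - zk) \<le> L * \<rho>" using L by (intro mult_left_mono) auto
      then have 1: "norm (snd (g ze) - snd (g zk)) \<le> \<epsilon> / 4" using lip[OF zC] \<rho>(2) by linarith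
      have "L * norm (k - e) \<le> L * \<rho>" using L k(2) by (intro mult_left_mono) (auto simp: norm_minus_commute)
      then have 2: "norm (snd (g k) - snd (g e)) \<le> \<epsilon> / 4" using lip[OF kC eC] \<rho>(2) by linarith
      have 3: "norm (snd (g zk) - y0) \<le> norm (snd (g k) - y0) + \<epsilon> / 2" using elim k(1) t unfolding zk_def by blast
      have "norm (snd (g ze) - y0) \<le> norm (snd (g ze) - snd (g zk)) + norm (snd (g zk) - y0)"
        using norm_triangle_ineq[of "snd (g ze) - snd (g zk)" "snd (g zk) - y0"] by simp
      moreover have "norm (snd (g k) - y0) \<le> norm (snd (g k) - snd (g e)) + norm (snd (g e) - y0)"
        using norm_triangle_ineq[of "snd (g k) - snd (g e)" "snd (g e) - y0"] by simp
      ultimately have "norm (snd (g ze) - y0) \<le> norm (snd (g e) - y0) + \<epsilon>" using 1 2 3 by linarith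
      then show "norm (snd (g ((1 - t) *\<^sub>R e + t *\<^sub>R v n)) - y0) \<le> norm (snd (g e) - y0) + \<epsilon>"
        by (simp add: ze_def)
    qed
  qed
qed

end

section \<open>Iteration words and the collapse of the second coordinate\<close>

text \<open>
  A word describes a map built from \<open>T\<close> by composition and convex combination. Rational coefficients keep
  the set of words countable, so that all words can be treated along one sequence, and are still dense
  enough for the values at one point to have a convex closure.
\<close>

datatype word = Start | Step word | Mix rat word word

instance word :: countable by countable_datatype

text \<open>
  Clamping a rational number to the unit interval spares a side condition in the datatype.
\<close>

definition weight :: "rat \<Rightarrow> real" where
  "weight q = max 0 (min 1 (real_of_rat q))"

fun word_eval :: "('a::real_vector \<Rightarrow> 'a) \<Rightarrow> word \<Rightarrow> 'a \<Rightarrow> 'a" where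
  "word_eval T Start x = x"
| "word_eval T (Step w) x = T (word_eval T w x)"
| "word_eval T (Mix q w w') x = (1 - weight q) *\<^sub>R word_eval T w x + weight q *\<^sub>R word_eval T w' x"

lemma weight_bounds: "0 \<le> weight q" "weight q \<le> 1"
  by (auto simp: weight_def)

lemma word_eval_in:
  assumes "convex C" "T \<in> C \<rightarrow> C" "x \<in> C"
  shows "word_eval T w x \<in> C"
proof (induction w)
  case (Mix q w w')
  then show ?case using convexD_alt[OF assms(1) _ _ weight_bounds] by simp
qed (use assms in auto)

context equivalent_norm begin

lemma word_eval_nonexpansive:
  assumes C: "convex C" and T: "T \<in> C \<rightarrow> C" "nonexpansive_on N C T"
  shows "nonexpansive_on N C (word_eval T w)"
proof -
  have "N (word_eval T w x - word_eval T w z) \<le> N (x - z)" if x: "x \<in> C" and z: "z \<in> C" for x z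
  proof (induction w)
    case (Step w)
    have "N (T (word_eval T w x) - T (word_eval T w z)) \<le> N (word_eval T w x - word_eval T w z)"
      using T(2) word_eval_in[OF C T(1)] x z unfolding nonexpansive_on_def by blast
    then show ?case using Step by simp
  next
    case (Mix q w w')
    let ?s = "weight q"
    have "word_eval T (Mix q w w') x - word_eval T (Mix q w w') z
        = (1 - ?s) *\<^sub>R (word_eval T w x - word_eval T w z) + ?s *\<^sub>R (word_eval T w' x - word_eval T w' z)"
      by (simp add: algebra_simps)
    then have "N (word_eval T (Mix q w w') x - word_eval T (Mix q w w') z)
        \<le> N ((1 - ?s) *\<^sub>R (word_eval T w x - word_eval T w z)) + N (?s *\<^sub>R (word_eval T w' x - word_eval T w' z))"
      by (simp only: triangle)
    also have "\<dots> = (1 - ?s) * N (word_eval T w x - word_eval T w z) + ?s * N (word_eval T w' x - word_eval T w' z)"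
      using weight_bounds[of q] by (simp add: scale)
    also have "\<dots> \<le> (1 - ?s) * N (x - z) + ?s * N (x - z)"
      using Mix weight_bounds[of q] by (intro add_mono mult_left_mono) auto
    also have "\<dots> = N (x - z)" by (simp add: algebra_simps)
    finally show ?case .
  qed simp
  then show ?thesis unfolding nonexpansive_on_def by blast
qed

lemma word_eval_approximate_fixed_point:
  assumes C: "convex C" and T: "T \<in> C \<rightarrow> C" "nonexpansive_on N C T"
    and v: "\<And>n. v n \<in> C" "(\<lambda>n. N (T (v n) - v n)) \<longlonglongrightarrow> 0"
  shows "(\<lambda>n. N (word_eval T w (v n) - v n)) \<longlonglongrightarrow> 0"
proof (induction w)
  case (Step w)
  have lim: "(\<lambda>n. N (word_eval T w (v n) - v n) + N (T (v n) - v n)) \<longlonglongrightarrow> 0"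
    using tendsto_add[OF Step v(2)] by simp
  show ?case
  proof (rule tendsto_sandwich[OF _ _ tendsto_const lim])
    have "N (T (word_eval T w (v n)) - T (v n)) \<le> N (word_eval T w (v n) - v n)" for n
      using T(2) word_eval_in[OF C T(1) v(1)] v(1) unfolding nonexpansive_on_def by blast
    then have "N (word_eval T (Step w) (v n) - v n) \<le> N (word_eval T w (v n) - v n) + N (T (v n) - v n)" for n
      using triangle3[of "T (word_eval T w (v n))" "v n" "T (v n)"] by (smt (verit) word_eval.simps(2))
    then show "\<forall>\<^sub>F n in sequentially. N (word_eval T (Step w) (v n) - v n)
        \<le> N (word_eval T w (v n) - v n) + N (T (v n) - v n)" by (intro always_eventually allI)
    show "\<forall>\<^sub>F n in sequentially. 0 \<le> N (word_eval T (Step w) (v n) - v n)"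
      using nonneg by (intro always_eventually allI)
  qed
next
  case (Mix q w w')
  have lim: "(\<lambda>n. (1 - weight q) * N (word_eval T w (v n) - v n) + weight q * N (word_eval T w' (v n) - v n)) \<longlonglongrightarrow> 0"
    using tendsto_add[OF tendsto_mult_right_zero[OF Mix(1)] tendsto_mult_right_zero[OF Mix(2)]] by simp
  show ?case
  proof (rule tendsto_sandwich[OF _ _ tendsto_const lim])
    show "\<forall>\<^sub>F n in sequentially. N (word_eval T (Mix q w w') (v n) - v n)
        \<le> (1 - weight q) * N (word_eval T w (v n) - v n) + weight q * N (word_eval T w' (v n) - v n)"
      unfolding word_eval.simps by (intro always_eventually allI convex_comb weight_bounds)
    show "\<forall>\<^sub>F n in sequentially. 0 \<le> N (word_eval T (Mix q w w') (v n) - v n)"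
      using nonneg by (intro always_eventually allI)
  qed
qed simp

lemma nonexpansive_continuous_on:
  assumes "nonexpansive_on N C g"
  shows "continuous_on C g"
proof (rule continuous_onI)
  fix x and e :: real assume x: "x \<in> C" and e: "e > 0"
  have "dist (g x') (g x) \<le> e" if "x' \<in> C" "dist x' x < \<alpha> * e / (\<bar>\<beta>\<bar> + 1)" for x'
  proof -
    have "\<alpha> * norm (g x' - g x) \<le> N (g x' - g x)" by (rule lower)
    also have "\<dots> \<le> N (x' - x)" using assms that x unfolding nonexpansive_on_def by blast
    also have "\<dots> \<le> \<beta> * norm (x' - x)" by (rule upper)
    also have "\<dots> \<le> (\<bar>\<beta>\<bar> + 1) * norm (x' - x)" by (intro mult_right_mono) auto
    also have "\<dots> \<le> \<alpha> * e" using that(2) by (simp add: dist_norm field_simps)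
    finally show ?thesis using alpha_pos by (simp add: dist_norm)
  qed
  then show "\<exists>d>0. \<forall>x'\<in>C. dist x' x < d \<longrightarrow> dist (g x') (g x) \<le> e"
    using alpha_pos e by (intro exI[of _ "\<alpha> * e / (\<bar>\<beta>\<bar> + 1)"]) (auto intro!: divide_pos_pos)
qed

end

text \<open>
  For two points of the orbit the clamped segment map sends rationals into the orbit, hence all reals into
  its closure; a limit argument extends this to points of the closure.
\<close>

lemma convex_closure_word_orbit:
  fixes c :: "'a::real_normed_vector"
  shows "convex (closure (range (\<lambda>w. word_eval T w c)))"
proof -
  let ?O = "range (\<lambda>w. word_eval T w c)"
  have seg: "(1 - t) *\<^sub>R x + t *\<^sub>R y \<in> closure ?O" if "x \<in> ?O" "y \<in> ?O" "0 \<le> t" "t \<le> 1" for x y and t :: real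
  proof -
    obtain w w' where w: "x = word_eval T w c" "y = word_eval T w' c"
      using \<open>x \<in> ?O\<close> \<open>y \<in> ?O\<close> by blast
    define \<phi> where "\<phi> s = (1 - max 0 (min 1 s)) *\<^sub>R x + max 0 (min 1 s) *\<^sub>R y" for s :: real
    have "\<phi> ` closure \<rat> \<subseteq> closure ?O"
    proof (rule image_closure_subset)
      show "continuous_on (closure \<rat>) \<phi>" unfolding \<phi>_def by (intro continuous_intros)
      show "\<phi> ` \<rat> \<subseteq> closure ?O"
      proof
        fix z assume "z \<in> \<phi> ` \<rat>"
        then obtain q where "z = \<phi> (real_of_rat q)" by (auto simp: Rats_def)
        then have "z = word_eval T (Mix q w w') c" by (simp add: \<phi>_def w weight_def)
        then have "z \<in> ?O" by (rule range_eqI)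
        then show "z \<in> closure ?O" by (rule subsetD[OF closure_subset])
      qed
    qed simp
    then have "\<phi> t \<in> closure ?O" by (auto simp: Rats_closure_real)
    then show ?thesis using that(3,4) by (simp add: \<phi>_def)
  qed
  show ?thesis
  proof (rule convexI_segment)
    fix x y t assume x: "x \<in> closure ?O" and y: "y \<in> closure ?O" and t: "0 \<le> t" "t \<le> (1::real)"
    obtain f where f: "\<And>n. f n \<in> ?O" "f \<longlonglongrightarrow> x" using x unfolding closure_sequential by blast
    obtain h where h: "\<And>n. h n \<in> ?O" "h \<longlonglongrightarrow> y" using y unfolding closure_sequential by blast
    have "(\<lambda>n. (1 - t) *\<^sub>R f n + t *\<^sub>R h n) \<longlonglongrightarrow> (1 - t) *\<^sub>R x + t *\<^sub>R y"
      by (intro tendsto_intros f(2) h(2))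
    then show "(1 - t) *\<^sub>R x + t *\<^sub>R y \<in> closure ?O"
      by (rule closed_sequentially[OF closed_closure seg[OF f(1) h(1) t]])
  qed
qed

text \<open>
  The closure of the word orbit is the closed convex invariant set generated by \<open>c\<close>, which minimality
  forces to be everything.
\<close>

lemma minimal_invariant_word_orbit_dense:
  assumes min: "minimal_invariant T C" and T: "continuous_on C T" and c: "c \<in> C"
  shows "closure (range (\<lambda>w. word_eval T w c)) = C"
proof (rule minimal_invariantD[OF min])
  let ?O = "range (\<lambda>w. word_eval T w c)"
  have C: "closed C" "convex C" "T \<in> C \<rightarrow> C" using min by (auto simp: minimal_invariant_def)
  have "?O \<subseteq> C" using word_eval_in[OF C(2,3) c] by blast
  then show sub: "closure ?O \<subseteq> C" using C(1) by (rule closure_minimal)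
  have "T ` closure ?O \<subseteq> closure ?O"
  proof (rule image_closure_subset)
    show "continuous_on (closure ?O) T" using T sub by (rule continuous_on_subset)
    show "T ` ?O \<subseteq> closure ?O"
    proof
      fix z assume "z \<in> T ` ?O"
      then obtain w where "z = word_eval T (Step w) c" by auto
      then have "z \<in> ?O" by (rule range_eqI)
      then show "z \<in> closure ?O" by (rule subsetD[OF closure_subset])
    qed
  qed simp
  then show "T \<in> closure ?O \<rightarrow> closure ?O" by blast
qed (auto simp: convex_closure_word_orbit)

context
  fixes nZ :: "real \<times> real \<Rightarrow> real"
  assumes nZ: "is_norm nZ" and mono: "strictly_monotone nZ"
begin

text \<open>
  The sequence \<open>u\<close> is picked from \<open>v\<close>, each term late enough to control the first maps on the finitely
  many terms already chosen. Errors \<open>(1/2)^i\<close> are summable, which \<open>flat_point_exists\<close> needs.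
\<close>

lemma flat_sequence_exists:
  fixes C :: "('a::real_normed_vector \<times> 'b::real_normed_vector) set" and g :: "nat \<Rightarrow> 'a \<times> 'b \<Rightarrow> 'a \<times> 'b"
  assumes C: "convex C" "bounded C" and v: "\<And>n. v n \<in> C"
    and dist: "\<And>c. c \<in> C \<Longrightarrow> (\<lambda>n. direct_sum_norm nZ (v n - c)) \<longlonglongrightarrow> d"
    and y0: "(\<lambda>n. snd (v n)) \<longlonglongrightarrow> y0"
    and g: "\<And>m. g m \<in> C \<rightarrow> C" "\<And>m. nonexpansive_on (direct_sum_norm nZ) C (g m)"
      "\<And>m. (\<lambda>n. direct_sum_norm nZ (g m (v n) - v n)) \<longlonglongrightarrow> 0"
  obtains u where "\<And>i. u i \<in> C"
    and "\<And>i m. m \<le> i \<Longrightarrow> norm (snd (g m (u i)) - y0) \<le> (1/2)^i"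
    and "\<And>i m e t. m \<le> i \<Longrightarrow> e \<in> convex hull (u ` {..<i}) \<Longrightarrow> 0 \<le> t \<Longrightarrow> t \<le> 1 \<Longrightarrow>
      norm (snd (g m ((1 - t) *\<^sub>R e + t *\<^sub>R u i)) - y0) \<le> norm (snd (g m e) - y0) + (1/2)^i"
proof -
  let ?N = "direct_sum_norm nZ :: 'a \<times> 'b \<Rightarrow> real"
  obtain \<alpha> \<beta> where "equivalent_norm ?N \<alpha> \<beta>" using direct_sum_equivalent_norm[OF nZ mono] by blast
  then interpret equivalent_norm ?N \<alpha> \<beta> .
  define P where "P u i x \<longleftrightarrow> x \<in> C \<and> (\<forall>m\<in>{..i}. norm (snd (g m x) - y0) \<le> (1/2)^i) \<and>
       (\<forall>m\<in>{..i}. \<forall>e \<in> convex hull (u ` {..<i}). \<forall>t. 0 \<le> t \<and> t \<le> 1 \<longrightarrow>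
          norm (snd (g m ((1 - t) *\<^sub>R e + t *\<^sub>R x)) - y0) \<le> norm (snd (g m e) - y0) + (1/2)^i)"
    for u :: "nat \<Rightarrow> 'a \<times> 'b" and i x
  have "\<exists>u. \<forall>i. P u i (u i)"
  proof (rule dependent_wellorder_choice)
    fix r and f h :: "nat \<Rightarrow> 'a \<times> 'b" and i :: nat assume "\<And>j. j < i \<Longrightarrow> f j = h j"
    then have "f ` {..<i} = h ` {..<i}" by (intro image_cong) auto
    then show "P f i r = P h i r" by (simp add: P_def)
  next
    fix i and f :: "nat \<Rightarrow> 'a \<times> 'b" assume IH: "\<And>j. j < i \<Longrightarrow> P f j (f j)"
    let ?S = "convex hull (f ` {..<i})"
    have "f ` {..<i} \<subseteq> C" using IH unfolding P_def by blast
    then have S: "compact ?S" "?S \<subseteq> C"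
      using C(1) by (simp_all add: finite_imp_compact_convex_hull hull_minimal)
    have small: "\<forall>\<^sub>F n in sequentially. norm (snd (g m (v n)) - y0) \<le> (1/2)^i" for m
    proof -
      have "(\<lambda>n. ?N (g m (v n) - v n) / \<alpha> + norm (snd (v n) - y0)) \<longlonglongrightarrow> 0"
        using tendsto_add[OF tendsto_divide_zero[OF g(3)[of m]] tendsto_norm_zero[OF LIM_zero[OF y0]]] by simp
      then have "\<forall>\<^sub>F n in sequentially. ?N (g m (v n) - v n) / \<alpha> + norm (snd (v n) - y0) < (1/2)^i"
        by (intro order_tendstoD) auto
      then show ?thesis
      proof eventually_elim
        case (elim n)
        have "norm (snd (g m (v n)) - snd (v n)) \<le> norm (g m (v n) - v n)"
          using norm_components_le(2)[of "g m (v n) - v n"] by simp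
        also have "\<dots> \<le> ?N (g m (v n) - v n) / \<alpha>"
          using lower[of "g m (v n) - v n"] alpha_pos by (simp add: field_simps)
        finally show ?case
          using elim norm_triangle_ineq[of "snd (g m (v n)) - snd (v n)" "snd (v n) - y0"] by simp
      qed
    qed
    have "\<forall>\<^sub>F n in sequentially. (\<forall>m\<in>{..i}. norm (snd (g m (v n)) - y0) \<le> (1/2)^i) \<and>
       (\<forall>m\<in>{..i}. \<forall>e \<in> ?S. \<forall>t. 0 \<le> t \<and> t \<le> 1 \<longrightarrow>
          norm (snd (g m ((1 - t) *\<^sub>R e + t *\<^sub>R v n)) - y0) \<le> norm (snd (g m e) - y0) + (1/2)^i)"
      by (intro eventually_conj eventually_ball_finite ballI small
          segment_height_uniform[OF nZ mono C v dist y0 g S]) auto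
    then obtain n where "P f i (v n)" unfolding P_def eventually_sequentially using v by blast
    then show "\<exists>r. P f i r" by blast
  qed
  then obtain u where "\<And>i. P u i (u i)" by blast
  then show thesis unfolding P_def by (intro that[of u]) auto
qed

text \<open>
  Adding the terms of \<open>u\<close> one after the other, the height of \<open>g m\<close> on the convex hull of the terms from
  index \<open>l\<close> on stays below \<open>2 * (1/2)^l\<close> once \<open>m \<le> l\<close>. By weak compactness the closures of these hulls
  have a common point \<open>c\<close>, a weak cluster point of \<open>u\<close>. It need not be close in norm to any single term,
  which is why the control on whole convex hulls is necessary.
\<close>

lemma flat_point_exists:
  fixes C :: "('a::real_normed_vector \<times> 'b::real_normed_vector) set" and g :: "nat \<Rightarrow> 'a \<times> 'b \<Rightarrow> 'a \<times> 'b"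
  assumes weak: "compactin (weak_topology norm) C"
    and C: "convex C" and v: "\<And>n. v n \<in> C"
    and dist: "\<And>c. c \<in> C \<Longrightarrow> (\<lambda>n. direct_sum_norm nZ (v n - c)) \<longlonglongrightarrow> d"
    and y0: "(\<lambda>n. snd (v n)) \<longlonglongrightarrow> y0"
    and g: "\<And>m. g m \<in> C \<rightarrow> C" "\<And>m. nonexpansive_on (direct_sum_norm nZ) C (g m)"
      "\<And>m. (\<lambda>n. direct_sum_norm nZ (g m (v n) - v n)) \<longlonglongrightarrow> 0"
  shows "\<exists>c\<in>C. \<forall>m. snd (g m c) = y0"
proof -
  let ?N = "direct_sum_norm nZ :: 'a \<times> 'b \<Rightarrow> real"
  obtain \<alpha> \<beta> where "equivalent_norm ?N \<alpha> \<beta>" using direct_sum_equivalent_norm[OF nZ mono] by blast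
  then interpret equivalent_norm ?N \<alpha> \<beta> .
  have clC: "closed C" using weak by (rule weakly_compact_imp_closed)
  have bd: "bounded C" using weak C by (rule weakly_compact_imp_bounded)
  obtain u where uC: "\<And>i. u i \<in> C"
    and start: "\<And>i m. m \<le> i \<Longrightarrow> norm (snd (g m (u i)) - y0) \<le> (1/2)^i"
    and step: "\<And>i m e t. m \<le> i \<Longrightarrow> e \<in> convex hull (u ` {..<i}) \<Longrightarrow> 0 \<le> t \<Longrightarrow> t \<le> 1 \<Longrightarrow>
          norm (snd (g m ((1 - t) *\<^sub>R e + t *\<^sub>R u i)) - y0) \<le> norm (snd (g m e) - y0) + (1/2)^i"
    by (rule flat_sequence_exists[where g = g, OF C bd v dist y0 g], assumption) (rule that)
  \<comment> \<open>The right-hand side is the sum of \<open>(1/2)^i\<close> for \<open>i\<close> from \<open>l\<close> to \<open>l + k\<close>.\<close>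
  have block: "norm (snd (g m e) - y0) \<le> 2 * (1/2)^l - (1/2)^(l + k)"
    if "m \<le> l" "e \<in> convex hull (u ` {l..l + k})" for m l k e
    using that(2)
  proof (induction k arbitrary: e)
    case 0
    then show ?case using start[OF that(1)] by simp
  next
    case (Suc k)
    have "u ` {l..l + Suc k} = insert (u (Suc (l + k))) (u ` {l..l + k})"
      by (simp add: atLeastAtMostSuc_conv)
    then have "e \<in> convex hull (insert (u (Suc (l + k))) (u ` {l..l + k}))" using Suc.prems by simp
    then obtain s e' where s: "0 \<le> s" "s \<le> 1" "e' \<in> convex hull (u ` {l..l + k})"
      and e: "e = (1 - s) *\<^sub>R u (Suc (l + k)) + s *\<^sub>R e'"
      unfolding convex_hull_insert_alt by (auto split: if_splits)
    have "convex hull (u ` {l..l + k}) \<subseteq> convex hull (u ` {..<Suc (l + k)})"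
      by (intro hull_mono image_mono) auto
    then have "norm (snd (g m ((1 - (1 - s)) *\<^sub>R e' + (1 - s) *\<^sub>R u (Suc (l + k)))) - y0)
        \<le> norm (snd (g m e') - y0) + (1/2)^Suc (l + k)"
      using s that(1) by (intro step) auto
    moreover have "(1 - (1 - s)) *\<^sub>R e' + (1 - s) *\<^sub>R u (Suc (l + k)) = e" by (simp add: e)
    ultimately show ?case using Suc.IH[OF s(3)] by simp
  qed
  define K where "K l = closure (convex hull (u ` {l..}))" for l
  have KC: "K l \<subseteq> C" for l
    unfolding K_def using uC C clC by (intro closure_minimal hull_minimal) auto
  have "\<exists>c\<in>C. \<forall>l. c \<in> K l"
  proof (rule weakly_compact_nested[OF weak])
    show "closed (K l) \<and> convex (K l) \<and> K l \<noteq> {} \<and> K l \<subseteq> C" for l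
      using KC[of l] by (auto simp: K_def convex_closure convex_convex_hull)
    show "K n \<subseteq> K m" if "m \<le> n" for m n
      unfolding K_def using that by (intro closure_mono hull_mono) auto
  qed
  then obtain c where c: "c \<in> C" "\<And>l. c \<in> K l" by blast
  have "snd (g m c) = y0" for m
  proof -
    have hull: "norm (snd (g m e) - y0) \<le> 2 * (1/2)^l" if "m \<le> l" "e \<in> convex hull (u ` {l..})" for l e
    proof -
      have "convex hull (u ` {l..}) \<subseteq> (\<Union>k. convex hull (u ` {l..l + k}))"
      proof (rule hull_minimal)
        show "u ` {l..} \<subseteq> (\<Union>k. convex hull (u ` {l..l + k}))"
        proof
          fix x assume "x \<in> u ` {l..}"
          then obtain i where "l \<le> i" "x = u i" by auto
          then have "x \<in> convex hull (u ` {l..l + (i - l)})" by (intro hull_inc) auto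
          then show "x \<in> (\<Union>k. convex hull (u ` {l..l + k}))" by blast
        qed
        show "convex (\<Union>k. convex hull (u ` {l..l + k}))"
        proof (rule convexI_segment)
          fix x y t assume x: "x \<in> (\<Union>k. convex hull (u ` {l..l + k}))" and y: "y \<in> (\<Union>k. convex hull (u ` {l..l + k}))"
            and t: "0 \<le> t" "t \<le> (1::real)"
          obtain i j where ij: "x \<in> convex hull (u ` {l..l + i})" "y \<in> convex hull (u ` {l..l + j})"
            using x y by blast
          have "convex hull (u ` {l..l + i}) \<subseteq> convex hull (u ` {l..l + max i j})"
            "convex hull (u ` {l..l + j}) \<subseteq> convex hull (u ` {l..l + max i j})"
            by (intro hull_mono image_mono; auto)+
          then have "(1 - t) *\<^sub>R x + t *\<^sub>R y \<in> convex hull (u ` {l..l + max i j})"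
            using ij t by (intro convexD_alt[OF convex_convex_hull]) auto
          then show "(1 - t) *\<^sub>R x + t *\<^sub>R y \<in> (\<Union>k. convex hull (u ` {l..l + k}))" by blast
        qed
      qed
      then obtain k where "e \<in> convex hull (u ` {l..l + k})"
        using \<open>e \<in> convex hull (u ` {l..})\<close> by blast
      from block[OF that(1) this] show ?thesis
        using zero_le_power[of "1/2 :: real" "l + k"] by linarith
    qed
    have bound: "norm (snd (g m c) - y0) \<le> 2 * (1/2)^l" if "m \<le> l" for l
    proof (rule continuous_on_closure_norm_le[where f = "\<lambda>e. snd (g m e) - y0"])
      show "continuous_on (closure (convex hull (u ` {l..}))) (\<lambda>e. snd (g m e) - y0)"
        using continuous_on_subset[OF nonexpansive_continuous_on[OF g(2)] KC[of l, unfolded K_def]]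
        by (intro continuous_intros)
      show "\<forall>e\<in>convex hull (u ` {l..}). norm (snd (g m e) - y0) \<le> 2 * (1/2)^l" using hull[OF that] by blast
      show "c \<in> closure (convex hull (u ` {l..}))" using c(2)[of l] by (simp add: K_def)
    qed
    have "(\<lambda>l. 2 * (1/2 :: real)^l) \<longlonglongrightarrow> 2 * 0" by (intro tendsto_intros LIMSEQ_realpow_zero) auto
    moreover have "\<forall>\<^sub>F l in sequentially. norm (snd (g m c) - y0) \<le> 2 * (1/2)^l"
      using bound unfolding eventually_sequentially by blast
    ultimately have "norm (snd (g m c) - y0) \<le> 2 * 0"
      by (intro tendsto_lowerbound) auto
    then show ?thesis by simp
  qed
  then show ?thesis using c(1) by blast
qed

text \<open>
  The maps described by all words send the point from \<open>flat_point_exists\<close> to second coordinate \<open>y0\<close>,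
  and its word orbit is dense.
\<close>

lemma minimal_invariant_in_slice:
  fixes C :: "('a::real_normed_vector \<times> 'b::real_normed_vector) set"
  assumes uced: "uniformly_convex_in_every_direction TYPE('b)"
    and weak: "compactin (weak_topology norm) C"
    and min: "minimal_invariant T C" and T: "nonexpansive_on (direct_sum_norm nZ) C T"
  shows "\<exists>y0. \<forall>c\<in>C. snd c = y0"
proof -
  let ?N = "direct_sum_norm nZ :: 'a \<times> 'b \<Rightarrow> real"
  obtain \<alpha> \<beta> where "equivalent_norm ?N \<alpha> \<beta>" using direct_sum_equivalent_norm[OF nZ mono] by blast
  then interpret equivalent_norm ?N \<alpha> \<beta> .
  have C: "C \<noteq> {}" "closed C" "convex C" "T \<in> C \<rightarrow> C" using min by (auto simp: minimal_invariant_def)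
  have bd: "bounded C" using weak C(3) by (rule weakly_compact_imp_bounded)
  obtain v where v: "\<And>n. v n \<in> C" "(\<lambda>n. ?N (T (v n) - v n)) \<longlonglongrightarrow> 0"
    using approximate_fixed_point_sequence[OF C(1,3) bd C(4) T] by blast
  obtain d where d: "\<And>c. c \<in> C \<Longrightarrow> (\<lambda>n. ?N (v n - c)) \<longlonglongrightarrow> d"
    using goebel_karlovitz[OF weak min T v] by blast
  have "\<exists>s y0. strict_mono s \<and> ((\<lambda>n. snd (v n)) \<circ> s) \<longlonglongrightarrow> y0"
  proof (rule uced_convergent_subsequence[OF uced])
    show "convex (snd ` C)" using C(3) linear_snd by (rule convex_linear_image[rotated])
    show "snd (v n) \<in> snd ` C" for n using v(1) by blast
    have "bounded (snd ` C)" using bd by (rule bounded_snd)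
    then show "bounded (range (\<lambda>n. snd (v n)))" by (rule bounded_subset) (use v(1) in auto)
    fix x x' :: 'b and t :: real assume x: "x \<in> snd ` C" "x' \<in> snd ` C" and t: "0 \<le> t" "t \<le> 1"
    obtain c c' where "c \<in> C" "x = snd c" "c' \<in> C" "x' = snd c'" using x by blast
    then show "(\<lambda>n. (1 - t) * norm (snd (v n) - x) + t * norm (snd (v n) - x')
        - norm (snd (v n) - ((1 - t) *\<^sub>R x + t *\<^sub>R x'))) \<longlonglongrightarrow> 0"
      using snd_dist_asymptotically_affine[OF nZ mono C(3) bd v(1) d _ _ t] by simp
  qed
  then obtain s y0 where s: "strict_mono (s :: nat \<Rightarrow> nat)" and y0: "(\<lambda>n. snd (v (s n))) \<longlonglongrightarrow> y0"
    by (auto simp: o_def)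
  have vs: "v (s n) \<in> C" for n by (rule v(1))
  have vs0: "(\<lambda>n. ?N (T (v (s n)) - v (s n))) \<longlonglongrightarrow> 0"
    using LIMSEQ_subseq_LIMSEQ[OF v(2) s] by (simp add: o_def)
  have vsd: "(\<lambda>n. ?N (v (s n) - c)) \<longlonglongrightarrow> d" if "c \<in> C" for c
    using LIMSEQ_subseq_LIMSEQ[OF d[OF that] s] by (simp add: o_def)
  define g where "g m = word_eval T (from_nat m)" for m
  have "\<exists>c\<in>C. \<forall>m. snd (g m c) = y0"
  proof (rule flat_point_exists[OF weak C(3) vs vsd y0])
    show "g m \<in> C \<rightarrow> C" for m unfolding g_def using word_eval_in[OF C(3,4)] by blast
    show "nonexpansive_on ?N C (g m)" for m unfolding g_def by (rule word_eval_nonexpansive[OF C(3,4) T])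
    show "(\<lambda>n. ?N (g m (v (s n)) - v (s n))) \<longlonglongrightarrow> 0" for m
      unfolding g_def by (rule word_eval_approximate_fixed_point[OF C(3,4) T vs vs0])
  qed
  then obtain c where c: "c \<in> C" "\<And>m. snd (g m c) = y0" by blast
  have "snd (word_eval T w c) = y0" for w using c(2)[of "to_nat w"] by (simp add: g_def)
  then have "range (\<lambda>w. word_eval T w c) \<subseteq> snd -` {y0}" by auto
  moreover have "closed (snd -` {y0} :: ('a \<times> 'b) set)" by (intro closed_vimage_snd) simp
  ultimately have "closure (range (\<lambda>w. word_eval T w c)) \<subseteq> snd -` {y0}" by (rule closure_minimal)
  then have "C \<subseteq> snd -` {y0}"
    using minimal_invariant_word_orbit_dense[OF min nonexpansive_continuous_on[OF T] c(1)] by simp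
  then have "\<forall>c\<in>C. snd c = y0" by auto
  then show ?thesis ..
qed

end

text \<open>
  On a slice the sum norm is a multiple of the norm of the first factor, so a minimal invariant set contained
  in a slice is a copy of a weakly compact convex subset of that factor.
\<close>

theorem theorem4p5:
  fixes nZ :: "real \<times> real \<Rightarrow> real"
  assumes "is_norm nZ"
    and "strictly_monotone nZ"
    and "weak_fixed_point_property (norm :: 'a::banach \<Rightarrow> real)"
    and "uniformly_convex_in_every_direction TYPE('b::banach)"
  shows "weak_fixed_point_property (direct_sum_norm nZ :: 'a \<times> 'b \<Rightarrow> real)"
  unfolding weak_fixed_point_property_def
proof (intro allI impI, elim conjE)
  fix C :: "('a \<times> 'b) set" and T :: "'a \<times> 'b \<Rightarrow> 'a \<times> 'b"
  let ?N = "direct_sum_norm nZ :: 'a \<times> 'b \<Rightarrow> real"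
  assume C: "C \<noteq> {}" "convex C" "compactin (weak_topology ?N) C"
    and T: "T \<in> C \<rightarrow> C" "nonexpansive_on ?N C T"
  obtain \<alpha> \<beta> where "equivalent_norm ?N \<alpha> \<beta>" using direct_sum_equivalent_norm[OF assms(1,2)] by blast
  then interpret equivalent_norm ?N \<alpha> \<beta> .
  have weak: "compactin (weak_topology norm) C" using C(3) by (simp add: weak_topology_eq)
  obtain M where M: "M \<subseteq> C" "minimal_invariant T M"
    using minimal_invariant_exists[OF weak C(1,2) T(1)] by blast
  have M': "M \<noteq> {}" "closed M" "convex M" "T \<in> M \<rightarrow> M" using M(2) by (auto simp: minimal_invariant_def)
  have TM: "nonexpansive_on ?N M T" using T(2) M(1) unfolding nonexpansive_on_def by blast
  have weakM: "compactin (weak_topology norm) M"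
    using weak M(1) closedin_weak_of_closed_convex[OF M'(2,3)] by (rule closed_compactin)
  obtain y0 where y0: "\<And>c. c \<in> M \<Longrightarrow> snd c = y0"
    using minimal_invariant_in_slice[OF assms(1,2,4) weakM M(2) TM] by blast
  define S where "S x = fst (T (x, y0))" for x
  have in_slice: "c = (fst c, y0)" if "c \<in> M" for c using y0[OF that] by (metis prod.collapse)
  have "\<exists>x\<in>fst ` M. S x = x"
  proof (rule assms(3)[unfolded weak_fixed_point_property_def, rule_format], intro conjI)
    show "fst ` M \<noteq> {}" using M' by simp
    show "convex (fst ` M)" using M'(3) linear_fst by (rule convex_linear_image[rotated])
    have "continuous_map (weak_topology norm) (weak_topology norm) (fst :: 'a \<times> 'b \<Rightarrow> 'a)"
    proof (rule continuous_map_into_weak)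
      fix f :: "'a \<Rightarrow> real" assume "bounded_linear f"
      then have "bounded_linear (\<lambda>p :: 'a \<times> 'b. f (fst p))"
        using bounded_linear_compose bounded_linear_fst by blast
      then show "continuous_map (weak_topology norm) euclideanreal (\<lambda>p :: 'a \<times> 'b. f (fst p))"
        by (rule continuous_map_weak_functional)
    qed
    then show "compactin (weak_topology norm) (fst ` M)" using weakM by (rule image_compactin[rotated])
    show "S \<in> fst ` M \<rightarrow> fst ` M"
    proof
      fix x assume "x \<in> fst ` M"
      then have "(x, y0) \<in> M" using in_slice by (metis imageE)
      then show "S x \<in> fst ` M" using M'(4) unfolding S_def by blast
    qed
    show "nonexpansive_on norm (fst ` M) S"
      unfolding nonexpansive_on_def
    proof (intro ballI)
      fix x x' assume "x \<in> fst ` M" "x' \<in> fst ` M"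
      then have x: "(x, y0) \<in> M" "(x', y0) \<in> M" using in_slice by (metis imageE)+
      have TT: "T (x, y0) = (S x, y0)" "T (x', y0) = (S x', y0)"
        unfolding S_def using in_slice M'(4) x by blast+
      have "?N (T (x, y0) - T (x', y0)) \<le> ?N ((x, y0) - (x', y0))"
        using TM x unfolding nonexpansive_on_def by blast
      then have le: "nZ (norm (S x - S x'), 0) \<le> nZ (norm (x - x'), 0)"
        unfolding TT by (simp add: direct_sum_norm_def)
      show "norm (S x - S x') \<le> norm (x - x')"
      proof (rule ccontr)
        assume "\<not> norm (S x - S x') \<le> norm (x - x')"
        then have "nZ (norm (x - x'), 0) < nZ (norm (S x - S x'), 0)"
          using assms(2) unfolding strictly_monotone_def by force
        then show False using le by simp
      qed
    qed
  qed
  then obtain c where c: "c \<in> M" "S (fst c) = fst c" by blast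
  have "T c = c"
    using c in_slice[OF c(1)] in_slice[of "T c"] M'(4) unfolding S_def by (metis Pi_iff)
  then show "\<exists>x\<in>C. T x = x" using c(1) M(1) by blast
qed

end
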